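(* Let $(Y,\xi)$ be a contact three-manifold which contains an embedded copy of $Q(1+\epsilon)$ for some $\epsilon>0$. Let $\alpha$ be a contact form for $(Y,\xi)$ which agrees with the form $dt-\lambda$ on $Q(1+\epsilon')$ for some $0<\epsilon'<\epsilon$. Then $(Y,\alpha)$ contains an embedded compact Legendrian $\Lambda_0$ such that for every $\delta>0$ there is a regular homotopy of Legendrians $\Lambda_t$, $t\in[0,1]$, starting at $\Lambda_0$, with oscillation energy less than $\delta$ and with no Reeb chords between $\Lambda_0$ and $\Lambda_1$.
   Context: $B(a)\subset\mathbb{C}$ is the open disk of area $a$ centered at $0$, $\lambda=\frac12(x\,dy-y\,dx)$, and $Q(a)=\mathbb{R}/\mathbb{Z}\times B(a)$ is the contact manifold with contact form $dt-\lambda$, $t\in\mathbb{R}/\mathbb{Z}$. An embedded copy of $Q(a)$ in $Y$ is the image of a contact embedding $Q(a)\to(Y,\xi)$; $Q(1+\epsilon')\subset Q(1+\epsilon)$ is regarded as a subset of $Y$ via this embedding. A regular homotopy of Legendrians is a smooth family of Legendrian immersions $i_t:\Lambda\to Y$, $t\in[0,1]$, of a compact manifold $\Lambda$, with $\Lambda_t$ denoting the immersed Legendrian $i_t$. With $h_t(x)=\alpha_{i_t(x)}(i_t'(x))$, its oscillation energy is $\int_0^1(\max_xh_t(x)-\min_xh_t(x))\,dt$. A Reeb chord between $\Lambda_0$ and $\Lambda_1$ is an $\alpha$-Reeb trajectory segment from a point $p\in i_0(\Lambda)$ to a point $\rho_a(p)\in i_1(\Lambda)$ for some $a\in\mathbb{R}$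 (zero and negative $a$ allowed), where $\rho_a$ is the time-$a$ Reeb flow. *)

theory Defs
  imports "HOL-Analysis.Analysis"
begin

section \<open>Smooth maps between Euclidean spaces\<close>

text \<open>\<open>C_diff k S f\<close>: on the open set \<open>S\<close>, all iterated directional derivatives
  of \<open>f\<close> of order at most \<open>k\<close> exist and are continuous.\<close>

primrec C_diff :: "nat \<Rightarrow> 'a::euclidean_space set \<Rightarrow> ('a \<Rightarrow> 'b::real_normed_vector) \<Rightarrow> bool" where
  "C_diff 0 S f \<longleftrightarrow> continuous_on S f"
| "C_diff (Suc k) S f \<longleftrightarrow>
     (\<forall>x\<in>S. f differentiable (at x)) \<and>
     (\<forall>v. C_diff k S (\<lambda>x. frechet_derivative f (at x) v))"

text \<open>The set \<open>S\<close> is arbitrary here; on a set that is not open, smoothness means that \<open>f\<close> has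
  smooth extensions locally. This is needed for families parametrized by \<open>[0,1]\<close>.\<close>

definition smooth_on :: "'a::euclidean_space set \<Rightarrow> ('a \<Rightarrow> 'b::real_normed_vector) \<Rightarrow> bool" where
  "smooth_on S f \<longleftrightarrow>
     (\<forall>x\<in>S. \<exists>U g. open U \<and> x \<in> U \<and> (\<forall>k. C_diff k U g) \<and> (\<forall>y\<in>S \<inter> U. g y = f y))"

section \<open>Smooth manifolds\<close>

type_synonym ('a, 'e) chart = "'a set \<times> ('a \<Rightarrow> 'e)"

record ('a, 'e) mfd =
  Top :: "'a topology"
  Atlas :: "('a, 'e) chart set"

abbreviation chart_dom :: "('a, 'e) chart \<Rightarrow> 'a set" where
  "chart_dom c \<equiv> fst c"

abbreviation coord :: "('a, 'e) chart \<Rightarrow> 'a \<Rightarrow> 'e" where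
  "coord c \<equiv> snd c"

abbreviation chart_ran :: "('a, 'e) chart \<Rightarrow> 'e set" where
  "chart_ran c \<equiv> coord c ` chart_dom c"

definition inv_coord :: "('a, 'e) chart \<Rightarrow> 'e \<Rightarrow> 'a" where
  "inv_coord c = the_inv_into (chart_dom c) (coord c)"

definition local_rep :: "('a, 'e) chart \<Rightarrow> ('a \<Rightarrow> 'b) \<Rightarrow> ('b, 'f) chart \<Rightarrow> 'e \<Rightarrow> 'f" where
  "local_rep c f d = coord d \<circ> f \<circ> inv_coord c"

definition differential ::
  "('a, 'e::euclidean_space) chart \<Rightarrow> ('a \<Rightarrow> 'b) \<Rightarrow> ('b, 'f::euclidean_space) chart \<Rightarrow> 'a \<Rightarrow> 'e \<Rightarrow> 'f" where
  "differential c f d p = frechet_derivative (local_rep c f d) (at (coord c p))"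

definition smooth_manifold :: "('a, 'e::euclidean_space) mfd \<Rightarrow> bool" where
  "smooth_manifold M \<longleftrightarrow>
     Hausdorff_space (Top M) \<and> second_countable (Top M) \<and>
     (\<Union>c\<in>Atlas M. chart_dom c) = topspace (Top M) \<and>
     (\<forall>c\<in>Atlas M. openin (Top M) (chart_dom c) \<and> open (chart_ran c) \<and>
        homeomorphic_map (subtopology (Top M) (chart_dom c)) (top_of_set (chart_ran c)) (coord c)) \<and>
     (\<forall>c\<in>Atlas M. \<forall>d\<in>Atlas M. smooth_on (coord c ` (chart_dom c \<inter> chart_dom d)) (local_rep c id d))"

definition smooth_map ::
  "('a, 'e::euclidean_space) mfd \<Rightarrow> ('b, 'f::euclidean_space) mfd \<Rightarrow> ('a \<Rightarrow> 'b) \<Rightarrow> bool" where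
  "smooth_map M N f \<longleftrightarrow>
     continuous_map (Top M) (Top N) f \<and>
     (\<forall>c\<in>Atlas M. \<forall>d\<in>Atlas N. smooth_on (coord c ` (chart_dom c \<inter> f -` chart_dom d)) (local_rep c f d))"

definition immersion ::
  "('a, 'e::euclidean_space) mfd \<Rightarrow> ('b, 'f::euclidean_space) mfd \<Rightarrow> ('a \<Rightarrow> 'b) \<Rightarrow> bool" where
  "immersion M N f \<longleftrightarrow>
     smooth_map M N f \<and>
     (\<forall>c\<in>Atlas M. \<forall>d\<in>Atlas N. \<forall>p\<in>chart_dom c. f p \<in> chart_dom d \<longrightarrow> inj (differential c f d p))"

definition smooth_embedding ::
  "('a, 'e::euclidean_space) mfd \<Rightarrow> ('b, 'f::euclidean_space) mfd \<Rightarrow> ('a \<Rightarrow> 'b) \<Rightarrow> bool" where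
  "smooth_embedding M N f \<longleftrightarrow> immersion M N f \<and> embedding_map (Top M) (Top N) f"

section \<open>Contact forms and contact structures\<close>

text \<open>A 1-form is given by its coordinate expressions: \<open>\<alpha> c u v\<close> is the value on the vector with
  components \<open>v\<close>, in the chart \<open>c\<close>, at the point with coordinates \<open>u\<close>. A field of subspaces of the
  tangent spaces is given by its coordinate expressions in the same way.\<close>

type_synonym ('a, 'e) form = "('a, 'e) chart \<Rightarrow> 'e \<Rightarrow> 'e \<Rightarrow> real"
type_synonym ('a, 'e) tangent_field = "('a, 'e) chart \<Rightarrow> 'e \<Rightarrow> 'e set"

definition one_form :: "('a, 'e::euclidean_space) mfd \<Rightarrow> ('a, 'e) form \<Rightarrow> bool" where
  "one_form M \<alpha> \<longleftrightarrow>
     (\<forall>c\<in>Atlas M. (\<forall>u\<in>chart_ran c. linear (\<alpha> c u)) \<and> (\<forall>v. smooth_on (chart_ran c) (\<lambda>u. \<alpha> c u v))) \<and>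
     (\<forall>c\<in>Atlas M. \<forall>d\<in>Atlas M. \<forall>p\<in>chart_dom c \<inter> chart_dom d. \<forall>v.
        \<alpha> d (coord d p) (differential c id d p v) = \<alpha> c (coord c p) v)"

definition ext_deriv :: "('e::euclidean_space \<Rightarrow> 'e \<Rightarrow> real) \<Rightarrow> 'e \<Rightarrow> 'e \<Rightarrow> 'e \<Rightarrow> real" where
  "ext_deriv a u v w =
     frechet_derivative (\<lambda>x. a x w) (at u) v - frechet_derivative (\<lambda>x. a x v) (at u) w"

text \<open>The expression below is \<open>(a \<and> da)(v, w, x)\<close> at \<open>u\<close>. In a space of dimension three, it is
  nonzero for some \<open>v\<close>, \<open>w\<close>, \<open>x\<close> iff the 3-form \<open>a \<and> da\<close> is a volume form at \<open>u\<close>.\<close>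

definition contact_at :: "('e::euclidean_space \<Rightarrow> 'e \<Rightarrow> real) \<Rightarrow> 'e \<Rightarrow> bool" where
  "contact_at a u \<longleftrightarrow>
     (\<exists>v w x. a u v * ext_deriv a u w x + a u w * ext_deriv a u x v + a u x * ext_deriv a u v w \<noteq> 0)"

definition contact_form :: "('a, 'e::euclidean_space) mfd \<Rightarrow> ('a, 'e) form \<Rightarrow> bool" where
  "contact_form M \<alpha> \<longleftrightarrow> one_form M \<alpha> \<and> (\<forall>c\<in>Atlas M. \<forall>u\<in>chart_ran c. contact_at (\<alpha> c) u)"

text \<open>Contact structures need not be cooriented: the defining contact form is local.\<close>

definition contact_structure :: "('a, 'e::euclidean_space) mfd \<Rightarrow> ('a, 'e) tangent_field \<Rightarrow> bool" where
  "contact_structure M \<xi> \<longleftrightarrow>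
     (\<forall>c\<in>Atlas M. \<forall>d\<in>Atlas M. \<forall>p\<in>chart_dom c \<inter> chart_dom d.
        differential c id d p ` \<xi> c (coord c p) = \<xi> d (coord d p)) \<and>
     (\<forall>c\<in>Atlas M. \<forall>u\<in>chart_ran c. \<exists>W a. open W \<and> u \<in> W \<and> W \<subseteq> chart_ran c \<and>
        (\<forall>v. smooth_on W (\<lambda>x. a x v)) \<and>
        (\<forall>x\<in>W. linear (a x) \<and> contact_at a x \<and> \<xi> c x = {v. a x v = 0}))"

definition ker_form :: "('a, 'e) form \<Rightarrow> ('a, 'e) tangent_field" where
  "ker_form \<alpha> c u = {v. \<alpha> c u v = 0}"

definition contact_form_for ::
  "('a, 'e::euclidean_space) mfd \<Rightarrow> ('a, 'e) tangent_field \<Rightarrow> ('a, 'e) form \<Rightarrow> bool" where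
  "contact_form_for M \<xi> \<alpha> \<longleftrightarrow>
     contact_form M \<alpha> \<and> (\<forall>c\<in>Atlas M. \<forall>u\<in>chart_ran c. \<xi> c u = ker_form \<alpha> c u)"

text \<open>Source and target have the same dimension in the following definition.\<close>

definition contact_embedding ::
  "('a, 'e::euclidean_space) mfd \<Rightarrow> ('a, 'e) tangent_field \<Rightarrow>
   ('b, 'f::euclidean_space) mfd \<Rightarrow> ('b, 'f) tangent_field \<Rightarrow> ('a \<Rightarrow> 'b) \<Rightarrow> bool" where
  "contact_embedding M \<xi> N \<zeta> f \<longleftrightarrow>
     smooth_embedding M N f \<and>
     (\<forall>c\<in>Atlas M. \<forall>d\<in>Atlas N. \<forall>p\<in>chart_dom c. f p \<in> chart_dom d \<longrightarrow>
        differential c f d p ` \<xi> c (coord c p) = \<zeta> d (coord d (f p)))"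

text \<open>\<open>f\<^sup>*\<alpha> = \<beta>\<close> at all points of \<open>P\<close>\<close>

definition pulls_back_on ::
  "'a set \<Rightarrow> ('a, 'e::euclidean_space) mfd \<Rightarrow> ('b, 'f::euclidean_space) mfd \<Rightarrow> ('a \<Rightarrow> 'b) \<Rightarrow>
   ('b, 'f) form \<Rightarrow> ('a, 'e) form \<Rightarrow> bool" where
  "pulls_back_on P M N f \<alpha> \<beta> \<longleftrightarrow>
     (\<forall>c\<in>Atlas M. \<forall>d\<in>Atlas N. \<forall>p\<in>chart_dom c \<inter> P. f p \<in> chart_dom d \<longrightarrow>
        (\<forall>v. \<alpha> d (coord d (f p)) (differential c f d p v) = \<beta> c (coord c p) v))"

section \<open>The contact manifold \<open>Q(a)\<close>\<close>

definition area_disk :: "real \<Rightarrow> complex set" where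
  "area_disk a = {z. pi * (cmod z)\<^sup>2 < a}"

definition lam :: "complex \<Rightarrow> complex \<Rightarrow> real" where
  "lam z w = (Re z * Im w - Im z * Re w) / 2"

text \<open>The circle \<open>\<real>/\<int>\<close> is realized as the unit circle in \<open>\<complex>\<close> through \<open>t \<mapsto> exp (2\<pi>it)\<close>. The charts of
  \<open>Q(a)\<close> are the local inverses of the resulting covering \<open>\<real> \<times> B(a) \<rightarrow> Q(a)\<close>, so that
  \<open>dt - \<lambda>\<close> has the same expression in all of them.\<close>

definition Q_cover :: "real \<times> complex \<Rightarrow> complex \<times> complex" where
  "Q_cover = (\<lambda>(t, z). (cis (2 * pi * t), z))"

definition Q :: "real \<Rightarrow> (complex \<times> complex, real \<times> complex) mfd" where
  "Q a = \<lparr> Top = top_of_set (sphere 0 1 \<times> area_disk a),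
           Atlas = {(Q_cover ` W, the_inv_into W Q_cover) | W.
                      open W \<and> W \<subseteq> UNIV \<times> area_disk a \<and> inj_on Q_cover W} \<rparr>"

definition Q_form :: "(complex \<times> complex, real \<times> complex) form" where
  "Q_form c = (\<lambda>(t, z) (\<tau>, w). \<tau> - lam z w)"

section \<open>Legendrians, their regular homotopies, and Reeb chords\<close>

text \<open>Legendrians in three-manifolds are one-dimensional, so their charts take values in \<open>\<real>\<close>.\<close>

definition legendrian_immersion ::
  "('l, real) mfd \<Rightarrow> ('y, real^3) mfd \<Rightarrow> ('y, real^3) tangent_field \<Rightarrow> ('l \<Rightarrow> 'y) \<Rightarrow> bool" where
  "legendrian_immersion L Y \<xi> f \<longleftrightarrow>
     immersion L Y f \<and>
     (\<forall>c\<in>Atlas L. \<forall>d\<in>Atlas Y. \<forall>p\<in>chart_dom c. f p \<in> chart_dom d \<longrightarrow>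
        range (differential c f d p) \<subseteq> \<xi> d (coord d (f p)))"

definition legendrian_embedding ::
  "('l, real) mfd \<Rightarrow> ('y, real^3) mfd \<Rightarrow> ('y, real^3) tangent_field \<Rightarrow> ('l \<Rightarrow> 'y) \<Rightarrow> bool" where
  "legendrian_embedding L Y \<xi> f \<longleftrightarrow> legendrian_immersion L Y \<xi> f \<and> smooth_embedding L Y f"

text \<open>Smoothness of \<open>(t, x) \<mapsto> i t x\<close> on \<open>[0,1] \<times> L\<close>\<close>

definition smooth_family :: "('l, real) mfd \<Rightarrow> ('y, real^3) mfd \<Rightarrow> (real \<Rightarrow> 'l \<Rightarrow> 'y) \<Rightarrow> bool" where
  "smooth_family L Y i \<longleftrightarrow>
     continuous_map (prod_topology (top_of_set {0..1}) (Top L)) (Top Y) (\<lambda>(t, x). i t x) \<and>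
     (\<forall>c\<in>Atlas L. \<forall>d\<in>Atlas Y.
        smooth_on {(t, u). t \<in> {0..1} \<and> u \<in> chart_ran c \<and> i t (inv_coord c u) \<in> chart_dom d}
          (\<lambda>(t, u). local_rep c (i t) d u))"

definition legendrian_regular_homotopy ::
  "('l, real) mfd \<Rightarrow> ('y, real^3) mfd \<Rightarrow> ('y, real^3) tangent_field \<Rightarrow> (real \<Rightarrow> 'l \<Rightarrow> 'y) \<Rightarrow> bool" where
  "legendrian_regular_homotopy L Y \<xi> i \<longleftrightarrow>
     smooth_family L Y i \<and> (\<forall>t\<in>{0..1}. legendrian_immersion L Y \<xi> (i t))"

text \<open>\<open>h t x = \<alpha> (\<partial>i/\<partial>t)\<close>, evaluated in some chart around \<open>i t x\<close>; the choice does not matter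
  because the coordinate expressions of \<open>\<alpha>\<close> are compatible.\<close>

definition homotopy_speed ::
  "('y, real^3) mfd \<Rightarrow> ('y, real^3) form \<Rightarrow> (real \<Rightarrow> 'l \<Rightarrow> 'y) \<Rightarrow> real \<Rightarrow> 'l \<Rightarrow> real" where
  "homotopy_speed Y \<alpha> i t x =
     (let d = (SOME d. d \<in> Atlas Y \<and> i t x \<in> chart_dom d)
      in \<alpha> d (coord d (i t x)) (vector_derivative (\<lambda>s. coord d (i s x)) (at t within {0..1})))"

text \<open>On a nonempty compact domain the supremum and infimum are attained.\<close>

definition oscillation_energy ::
  "('l, real) mfd \<Rightarrow> ('y, real^3) mfd \<Rightarrow> ('y, real^3) form \<Rightarrow> (real \<Rightarrow> 'l \<Rightarrow> 'y) \<Rightarrow> real" where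
  "oscillation_energy L Y \<alpha> i =
     integral {0..1} (\<lambda>t. (SUP x\<in>topspace (Top L). homotopy_speed Y \<alpha> i t x)
                        - (INF x\<in>topspace (Top L). homotopy_speed Y \<alpha> i t x))"

definition reeb_vector :: "('e::euclidean_space \<Rightarrow> 'e \<Rightarrow> real) \<Rightarrow> 'e \<Rightarrow> 'e \<Rightarrow> bool" where
  "reeb_vector a u v \<longleftrightarrow> a u v = 1 \<and> (\<forall>w. ext_deriv a u v w = 0)"

definition reeb_trajectory ::
  "('a, 'e::euclidean_space) mfd \<Rightarrow> ('a, 'e) form \<Rightarrow> real set \<Rightarrow> (real \<Rightarrow> 'a) \<Rightarrow> bool" where
  "reeb_trajectory M \<alpha> T \<gamma> \<longleftrightarrow>
     continuous_map (top_of_set T) (Top M) \<gamma> \<and>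
     (\<forall>c\<in>Atlas M. \<forall>t\<in>T. \<gamma> t \<in> chart_dom c \<longrightarrow>
        (\<exists>v. reeb_vector (\<alpha> c) (coord c (\<gamma> t)) v \<and>
             ((\<lambda>s. coord c (\<gamma> s)) has_vector_derivative v) (at t within T)))"

text \<open>A chord of time \<open>a\<close> from \<open>A\<close> to \<open>B\<close>. The time may be negative or zero; a common point of \<open>A\<close> and \<open>B\<close>
  is a chord of time zero.\<close>

definition reeb_chord ::
  "('a, 'e::euclidean_space) mfd \<Rightarrow> ('a, 'e) form \<Rightarrow> 'a set \<Rightarrow> 'a set \<Rightarrow> real \<Rightarrow> (real \<Rightarrow> 'a) \<Rightarrow> bool" where
  "reeb_chord M \<alpha> A B a \<gamma> \<longleftrightarrow>
     reeb_trajectory M \<alpha> (closed_segment 0 a) \<gamma> \<and> \<gamma> 0 \<in> A \<and> \<gamma> a \<in> B"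

end

theory Submission
  imports Defs
begin

text \<open>Let \<open>\<Lambda>\<^sub>0\<close> be the lift of the circle of area 1; it closes up because the area equals the period of \<open>t\<close>.
  In \<open>Q(1 + \<epsilon>')\<close> the Reeb flow is rotation of the \<open>t\<close>-circle, so every Reeb trajectory meeting \<open>\<Lambda>\<^sub>0\<close>
  stays over that circle, and it suffices to move \<open>\<Lambda>\<^sub>0\<close> to a Legendrian whose projection avoids the
  circle. In action-angle coordinates a neighborhood of \<open>\<Lambda>\<^sub>0\<close> is the 1-jet space of the circle with form
  \<open>dT - y d\<psi>\<close> and \<open>\<Lambda>\<^sub>0\<close> is its zero section. The zero section is regularly homotopic, through
  Legendrian immersions, to one with \<open>y > 0\<close> everywhere (its front zigzags). The scaling
  \<open>(y, T) \<mapsto> (\<eta> y, \<eta> T)\<close> multiplies the contact form, hence the oscillation energy, by \<open>\<eta>\<close>.\<close>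

text \<open>A Legendrian curve closes up in the T-direction only if the integral of y d\<psi> around
  it vanishes. With y > 0 this forces \<psi>' to change sign, hence the zigzags; 1-jets of functions
  f do not suffice, since y = f' vanishes somewhere on the circle. In the family used here, the part
  of \<psi>' that correlates with sin \<theta> is - 16 s sin \<theta> cos^2 \<theta>. As sin^2 cos^2
  has mean 1/8, it lowers the mean of y \<psi>' by 2 s^2, which pays for raising y by 2 s^2. The
  factor 8 is large enough that at s = 1 this rise exceeds the amplitude of sin \<theta>. Two points
  need care. The homotopy has to stay over B(1 + \<epsilon>'), where \<alpha> is known; this is
  another smallness condition on \<eta>. And a Reeb trajectory of Y might a priori leave the
  embedded copy and come back; this is excluded by showing that the times at which it lies over the
  circle of area 1 form an open and closed set.\<close>

section \<open>Calculus of \<open>C_diff\<close>\<close>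

lemma frechet_derivative_cong_open:
  assumes "open S" "x \<in> S" "\<And>y. y \<in> S \<Longrightarrow> f y = g y"
  shows "frechet_derivative f (at x) = frechet_derivative g (at x)"
proof -
  have "(f has_derivative D) (at x) \<longleftrightarrow> (g has_derivative D) (at x)" for D
    using has_derivative_transform_within_open[of f D x UNIV S g]
      has_derivative_transform_within_open[of g D x UNIV S f] assms by auto
  then show ?thesis by (simp add: frechet_derivative_def)
qed

lemma C_diff_cong_imp:
  assumes "open S" "\<And>x. x \<in> S \<Longrightarrow> f x = g x" "C_diff k S f"
  shows "C_diff k S g"
  using assms(2,3)
proof (induction k arbitrary: f g)
  case 0
  then show ?case using continuous_on_cong by force
next
  case (Suc k)
  have "g differentiable (at x)" if "x \<in> S" for x
  proof -
    have "(f has_derivative frechet_derivative f (at x)) (at x)"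
      using Suc.prems(2) that frechet_derivative_works by auto
    then have "(g has_derivative frechet_derivative f (at x)) (at x)"
      by (rule has_derivative_transform_within_open[of f _ x UNIV S g])
         (use that assms(1) Suc.prems(1) in auto)
    then show ?thesis by (auto simp: differentiable_def)
  qed
  moreover have "C_diff k S (\<lambda>x. frechet_derivative g (at x) v)" for v
    by (rule Suc.IH[of "\<lambda>x. frechet_derivative f (at x) v"])
       (use Suc.prems frechet_derivative_cong_open[OF assms(1), of _ f g] in auto)
  ultimately show ?case by simp
qed

text \<open>The sum, product, pairing and chain rules below go by induction on \<open>k\<close>
  through this rule: the derivative is given by a formula, to which the induction hypothesis applies
  for each fixed direction \<open>v\<close>.\<close>

lemma C_diff_SucI:
  assumes "open S" "\<And>x. x \<in> S \<Longrightarrow> (f has_derivative f' x) (at x)" "\<And>v. C_diff k S (\<lambda>x. f' x v)"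
  shows "C_diff (Suc k) S f"
proof -
  have "frechet_derivative f (at x) = f' x" if "x \<in> S" for x
    using frechet_derivative_at[OF assms(2)[OF that]] by (rule sym)
  then have "C_diff k S (\<lambda>x. frechet_derivative f (at x) v)" for v
    by (intro C_diff_cong_imp[OF assms(1) _ assms(3)]) simp
  then show ?thesis using assms(2) by (auto simp: differentiable_def)
qed

lemma C_diff_Suc_has_derivative:
  "C_diff (Suc k) S f \<Longrightarrow> x \<in> S \<Longrightarrow> (f has_derivative frechet_derivative f (at x)) (at x)"
  using frechet_derivative_works by auto

text \<open>The derivative of a product or composite contains undifferentiated factors, which
  therefore must have class \<open>k\<close> as well.\<close>

lemma C_diff_SucD: "C_diff (Suc k) S f \<Longrightarrow> C_diff k S f"
proof (induction k arbitrary: f)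
  case 0
  then show ?case
    by (auto intro!: continuous_at_imp_continuous_on differentiable_imp_continuous_within)
qed auto

lemma C_diff_imp_continuous_on: "C_diff k S f \<Longrightarrow> continuous_on S f"
  by (induction k) (use C_diff_SucD in \<open>auto simp del: C_diff.simps(2)\<close>)

lemma C_diff_subset: "C_diff k S f \<Longrightarrow> T \<subseteq> S \<Longrightarrow> C_diff k T f"
  by (induction k arbitrary: f) (auto intro: continuous_on_subset)

lemma C_diff_const: "C_diff k S (\<lambda>x. c)"
proof (induction k arbitrary: c)
  case (Suc k)
  have "frechet_derivative (\<lambda>x. c) (at x) = (\<lambda>v. 0)" for x :: 'a
    using frechet_derivative_at[OF has_derivative_const] by (rule sym)
  then show ?case using Suc by simp
qed simp

lemma C_diff_bounded_linear:
  assumes "bounded_linear h" shows "C_diff k S h"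
proof (cases k)
  case 0
  then show ?thesis using assms by (simp add: linear_continuous_on)
next
  case (Suc l)
  have "frechet_derivative h (at x) = h" for x
    using frechet_derivative_at[OF bounded_linear_imp_has_derivative[OF assms]] by (rule sym)
  then show ?thesis
    using Suc assms bounded_linear_imp_differentiable C_diff_const by auto
qed

lemma C_diff_add:
  assumes "open S" "C_diff k S f" "C_diff k S g"
  shows "C_diff k S (\<lambda>x. f x + g x)"
  using assms(2,3)
proof (induction k arbitrary: f g)
  case 0
  then show ?case by (simp add: continuous_on_add)
next
  case (Suc k)
  let ?f' = "\<lambda>x. frechet_derivative f (at x)" and ?g' = "\<lambda>x. frechet_derivative g (at x)"
  note D = C_diff_Suc_has_derivative[OF Suc.prems(1)] C_diff_Suc_has_derivative[OF Suc.prems(2)]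
  have C: "C_diff k S f" "C_diff k S g" "\<And>v. C_diff k S (\<lambda>x. ?f' x v)" "\<And>v. C_diff k S (\<lambda>x. ?g' x v)"
    using Suc.prems[THEN C_diff_SucD] Suc.prems by simp_all
  show ?case
  proof (rule C_diff_SucI[OF assms(1), where f' = "\<lambda>x v. ?f' x v + ?g' x v"])
    show "((\<lambda>x. f x + g x) has_derivative (\<lambda>v. ?f' x v + ?g' x v)) (at x)" if "x \<in> S" for x
      using that by (intro has_derivative_add D)
    show "C_diff k S (\<lambda>x. ?f' x v + ?g' x v)" for v by (intro Suc.IH C)
  qed
qed

lemma C_diff_sum:
  assumes "open S" "\<And>i. i \<in> I \<Longrightarrow> C_diff k S (f i)"
  shows "C_diff k S (\<lambda>x. \<Sum>i\<in>I. f i x)"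
proof (cases "finite I")
  case True
  then show ?thesis using assms(2)
  proof (induction I)
    case empty
    show ?case unfolding sum.empty by (rule C_diff_const)
  next
    case (insert i I)
    show ?case unfolding sum.insert[OF insert.hyps]
      by (rule C_diff_add[OF assms(1) insert.prems insert.IH[OF insert.prems]]) blast+
  qed
next
  case False
  show ?thesis unfolding sum.infinite[OF False] by (rule C_diff_const)
qed

lemma C_diff_bilinear:
  assumes "open S" "bounded_bilinear p" "C_diff k S f" "C_diff k S g"
  shows "C_diff k S (\<lambda>x. p (f x) (g x))"
  using assms(3,4)
proof (induction k arbitrary: f g)
  case 0
  then show ?case using bounded_bilinear.continuous_on[OF assms(2)] by auto
next
  case (Suc k)
  let ?f' = "\<lambda>x. frechet_derivative f (at x)" and ?g' = "\<lambda>x. frechet_derivative g (at x)"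
  note D = C_diff_Suc_has_derivative[OF Suc.prems(1)] C_diff_Suc_has_derivative[OF Suc.prems(2)]
  have C: "C_diff k S f" "C_diff k S g" "\<And>v. C_diff k S (\<lambda>x. ?f' x v)" "\<And>v. C_diff k S (\<lambda>x. ?g' x v)"
    using Suc.prems[THEN C_diff_SucD] Suc.prems by simp_all
  show ?case
  proof (rule C_diff_SucI[OF assms(1), where f' = "\<lambda>x v. p (f x) (?g' x v) + p (?f' x v) (g x)"])
    show "((\<lambda>x. p (f x) (g x)) has_derivative (\<lambda>v. p (f x) (?g' x v) + p (?f' x v) (g x))) (at x)"
      if "x \<in> S" for x
      using that by (intro bounded_bilinear.FDERIV[OF assms(2)] D)
    show "C_diff k S (\<lambda>x. p (f x) (?g' x v) + p (?f' x v) (g x))" for v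
      by (intro C_diff_add[OF assms(1)] Suc.IH C)
  qed
qed

lemmas C_diff_mult = C_diff_bilinear[OF _ bounded_bilinear_mult]
lemmas C_diff_scaleR = C_diff_bilinear[OF _ bounded_bilinear_scaleR]

lemma C_diff_linear_image:
  assumes "open S" "bounded_linear h" "C_diff k S f"
  shows "C_diff k S (\<lambda>x. h (f x))"
  using assms(3)
proof (induction k arbitrary: f)
  case 0
  then show ?case using bounded_linear.continuous_on[OF assms(2)] by auto
next
  case (Suc k)
  let ?f' = "\<lambda>x. frechet_derivative f (at x)"
  show ?case
  proof (rule C_diff_SucI[OF assms(1), where f' = "\<lambda>x v. h (?f' x v)"])
    show "((\<lambda>x. h (f x)) has_derivative (\<lambda>v. h (?f' x v))) (at x)" if "x \<in> S" for x
      using that by (intro bounded_linear.has_derivative[OF assms(2)] C_diff_Suc_has_derivative[OF Suc.prems])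
    show "C_diff k S (\<lambda>x. h (?f' x v))" for v using Suc by simp
  qed
qed

lemma C_diff_Pair:
  assumes "open S" "C_diff k S f" "C_diff k S g"
  shows "C_diff k S (\<lambda>x. (f x, g x))"
  using assms(2,3)
proof (induction k arbitrary: f g)
  case 0
  then show ?case by (simp add: continuous_on_Pair)
next
  case (Suc k)
  let ?f' = "\<lambda>x. frechet_derivative f (at x)" and ?g' = "\<lambda>x. frechet_derivative g (at x)"
  note D = C_diff_Suc_has_derivative[OF Suc.prems(1)] C_diff_Suc_has_derivative[OF Suc.prems(2)]
  have C: "C_diff k S f" "C_diff k S g" "\<And>v. C_diff k S (\<lambda>x. ?f' x v)" "\<And>v. C_diff k S (\<lambda>x. ?g' x v)"
    using Suc.prems[THEN C_diff_SucD] Suc.prems by simp_all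
  show ?case
  proof (rule C_diff_SucI[OF assms(1), where f' = "\<lambda>x v. (?f' x v, ?g' x v)"])
    show "((\<lambda>x. (f x, g x)) has_derivative (\<lambda>v. (?f' x v, ?g' x v))) (at x)" if "x \<in> S" for x
      using that by (intro has_derivative_Pair D)
    show "C_diff k S (\<lambda>x. (?f' x v, ?g' x v))" for v by (intro Suc.IH C)
  qed
qed

text \<open>In g'(f x)(f' x v) the direction moves with x, whereas \<open>C_diff\<close> controls
  derivatives in fixed directions only. Expanding f' x v in the basis leaves a sum of products of
  functions of class \<open>k\<close>.\<close>

lemma C_diff_compose:
  fixes f :: "'a::euclidean_space \<Rightarrow> 'b::euclidean_space"
  assumes "open S" "C_diff k T g" "C_diff k S f" "f ` S \<subseteq> T"
  shows "C_diff k S (\<lambda>x. g (f x))"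
  using assms(2,3)
proof (induction k arbitrary: g)
  case 0
  then show ?case using continuous_on_compose2 assms(4) by (simp, blast)
next
  case (Suc k)
  let ?g' = "\<lambda>y. frechet_derivative g (at y)" and ?f' = "\<lambda>x. frechet_derivative f (at x)"
  have eq: "?g' (f x) w = (\<Sum>b\<in>Basis. (w \<bullet> b) *\<^sub>R ?g' (f x) b)" if "x \<in> S" for x w
  proof -
    have "linear (?g' (f x))"
      using C_diff_Suc_has_derivative[OF Suc.prems(1)] that assms(4) has_derivative_linear by blast
    then show ?thesis
      by (subst (1) euclidean_representation[symmetric, of w])
         (simp only: linear_sum linear_cmul o_def)
  qed
  have "(\<lambda>x. g (f x)) differentiable at x \<and> frechet_derivative (\<lambda>x. g (f x)) (at x) = (\<lambda>v. ?g' (f x) (?f' x v))"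
    if "x \<in> S" for x
  proof -
    have "((\<lambda>x. g (f x)) has_derivative (\<lambda>v. ?g' (f x) (?f' x v))) (at x)"
      using has_derivative_compose[OF C_diff_Suc_has_derivative[OF Suc.prems(2) that]
        C_diff_Suc_has_derivative[OF Suc.prems(1)]] that assms(4) by blast
    then show ?thesis using frechet_derivative_at by (metis differentiable_def)
  qed
  then have D: "\<And>x. x \<in> S \<Longrightarrow> ((\<lambda>x. g (f x)) has_derivative (\<lambda>v. \<Sum>b\<in>Basis. (?f' x v \<bullet> b) *\<^sub>R ?g' (f x) b)) (at x)"
    using eq by (metis (no_types, lifting) ext frechet_derivative_works)
  show ?case
  proof (rule C_diff_SucI[OF assms(1) D])
    fix v
    have "C_diff k S (\<lambda>x. ?g' (f x) b)" for b
      using Suc.prems(1) by (intro Suc.IH C_diff_SucD[OF Suc.prems(2)]) simp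
    moreover have "C_diff k S (\<lambda>x. ?f' x v \<bullet> b)" for b
      using Suc.prems by (intro C_diff_linear_image[OF assms(1) bounded_linear_inner_left]) auto
    ultimately show "C_diff k S (\<lambda>x. \<Sum>b\<in>Basis. (?f' x v \<bullet> b) *\<^sub>R ?g' (f x) b)"
      by (intro C_diff_sum C_diff_scaleR assms(1))
  qed
qed

lemma C_diff_sin_cos: "C_diff k UNIV (sin :: real \<Rightarrow> real) \<and> C_diff k UNIV (cos :: real \<Rightarrow> real)"
proof (induction k)
  case 0
  then show ?case by (simp add: continuous_on_sin continuous_on_cos)
next
  case (Suc k)
  have "C_diff (Suc k) UNIV (sin :: real \<Rightarrow> real)"
  proof (rule C_diff_SucI[where f' = "\<lambda>x v. v * cos x"])
    show "C_diff k UNIV (\<lambda>x. v * cos x)" for v :: real using Suc by (intro C_diff_mult C_diff_const) auto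
  qed (auto intro!: derivative_eq_intros)
  moreover have "C_diff (Suc k) UNIV (cos :: real \<Rightarrow> real)"
  proof (rule C_diff_SucI[where f' = "\<lambda>x v. (- v) * sin x"])
    show "C_diff k UNIV (\<lambda>x. (- v) * sin x)" for v :: real using Suc by (intro C_diff_mult C_diff_const) auto
  qed (auto intro!: derivative_eq_intros)
  ultimately show ?case by simp
qed

text \<open>The exponent is arbitrary because differentiation lowers it by one; the square root is
  the case 1/2.\<close>

lemma C_diff_powr: "C_diff k {0<..} (\<lambda>x::real. x powr a)"
proof (induction k arbitrary: a)
  case 0
  then show ?case by (auto intro!: continuous_intros)
next
  case (Suc k)
  show ?case
  proof (rule C_diff_SucI[where f' = "\<lambda>x v. (v * a) * x powr (a - 1)"])
    show "C_diff k {0<..} (\<lambda>x. (v * a) * x powr (a - 1))" for v :: real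
      by (intro C_diff_mult C_diff_const Suc) auto
  qed (auto intro!: derivative_eq_intros simp: powr_diff field_simps)
qed

lemma C_diff_sqrt: "C_diff k {0<..} sqrt"
  by (rule C_diff_cong_imp[OF _ _ C_diff_powr[of k "1/2"]]) (auto simp: powr_half_sqrt)

lemma C_diff_cis: "C_diff k UNIV cis"
proof -
  have "C_diff k UNIV (\<lambda>t. cos t *\<^sub>R (1::complex) + sin t *\<^sub>R \<i>)"
    using C_diff_sin_cos by (intro C_diff_add C_diff_scaleR C_diff_const) auto
  then show ?thesis by (rule C_diff_cong_imp[rotated 2]) (auto simp: complex_eq_iff)
qed

lemma C_diff_uminus: "open S \<Longrightarrow> C_diff k S f \<Longrightarrow> C_diff k S (\<lambda>x. - f x)"
  by (rule C_diff_linear_image) (auto intro: bounded_linear_minus bounded_linear_ident)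

lemma C_diff_diff: "open S \<Longrightarrow> C_diff k S f \<Longrightarrow> C_diff k S g \<Longrightarrow> C_diff k S (\<lambda>x. f x - g x)"
  using C_diff_add[of S k f "\<lambda>x. - g x"] C_diff_uminus[of S k g] by simp

lemma C_diff_power:
  fixes f :: "'a::euclidean_space \<Rightarrow> real"
  shows "open S \<Longrightarrow> C_diff k S f \<Longrightarrow> C_diff k S (\<lambda>x. f x ^ n)"
  by (induction n) (simp_all add: C_diff_const C_diff_mult)

lemma C_diff_divide_const:
  fixes f :: "'a::euclidean_space \<Rightarrow> real"
  shows "open S \<Longrightarrow> C_diff k S f \<Longrightarrow> C_diff k S (\<lambda>x. f x / c)"
  using C_diff_mult[OF _ _ C_diff_const, of S k f "inverse c"] by (simp add: divide_inverse)

lemma C_diff_trig: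
  fixes f :: "'a::euclidean_space \<Rightarrow> real"
  assumes "open S" "C_diff k S f"
  shows "C_diff k S (\<lambda>x. sin (f x))" "C_diff k S (\<lambda>x. cos (f x))" "C_diff k S (\<lambda>x. cis (f x))"
  using assms C_diff_sin_cos C_diff_cis by (auto intro: C_diff_compose)

section \<open>Passing between \<open>smooth_on\<close> and \<open>C_diff\<close>\<close>

lemma smooth_onI:
  assumes "\<And>x. x \<in> S \<Longrightarrow> \<exists>U g. open U \<and> x \<in> U \<and> (\<forall>k. C_diff k U g) \<and> (\<forall>y\<in>S \<inter> U. g y = f y)"
  shows "smooth_on S f"
  using assms by (simp add: smooth_on_def)

lemma smooth_on_open_C_diff:
  assumes "open S" "smooth_on S f" "x \<in> S"
  obtains U where "open U" "x \<in> U" "U \<subseteq> S" "\<And>k. C_diff k U f"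
proof -
  obtain U g where U: "open U" "x \<in> U" "\<And>k. C_diff k U g" "\<And>y. y \<in> S \<inter> U \<Longrightarrow> g y = f y"
    using assms unfolding smooth_on_def by metis
  show thesis
  proof (rule that[of "S \<inter> U"])
    show "C_diff k (S \<inter> U) f" for k
      by (rule C_diff_cong_imp[OF _ _ C_diff_subset[OF U(3)]]) (use U assms(1) in auto)
  qed (use U assms in auto)
qed

section \<open>Symmetry of second derivatives, and the exterior derivative of a pullback\<close>

text \<open>The mean value theorem is applied along v to the increment of f by h w, and then along w
  to the derivative of f in direction v.\<close>

lemma mixed_difference_quotient:
  fixes f :: "'a::euclidean_space \<Rightarrow> real"
  assumes "C_diff 2 V f" "h > 0"
    and V: "\<And>s t. 0 \<le> s \<Longrightarrow> s \<le> h \<Longrightarrow> 0 \<le> t \<Longrightarrow> t \<le> h \<Longrightarrow> u + s *\<^sub>R v + t *\<^sub>R w \<in> V"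
  obtains s t where "0 < s" "s < h" "0 < t" "t < h"
    "f (u + h *\<^sub>R v + h *\<^sub>R w) - f (u + h *\<^sub>R v) - f (u + h *\<^sub>R w) + f u
      = h * h * frechet_derivative (\<lambda>x. frechet_derivative f (at x) v) (at (u + s *\<^sub>R v + t *\<^sub>R w)) w"
proof -
  let ?f' = "\<lambda>x. frechet_derivative f (at x)"
  have f1: "C_diff (Suc 1) V f" using assms(1) by (simp add: numeral_2_eq_2)
  have f2: "C_diff (Suc 0) V (\<lambda>x. ?f' x v)" using f1 by simp
  define g where "g s = f (u + s *\<^sub>R v + h *\<^sub>R w) - f (u + s *\<^sub>R v)" for s
  have line: "((\<lambda>s. F (p + s *\<^sub>R q)) has_real_derivative frechet_derivative F (at (p + s *\<^sub>R q)) q) (at s)"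
    if "C_diff (Suc k) V F" "p + s *\<^sub>R q \<in> V" for F :: "'a \<Rightarrow> real" and p q s k
  proof -
    have 1: "((\<lambda>s. p + s *\<^sub>R q) has_derivative (\<lambda>s. s *\<^sub>R q)) (at s)"
      by (auto intro!: derivative_eq_intros)
    have lin: "linear (frechet_derivative F (at (p + s *\<^sub>R q)))"
      using C_diff_Suc_has_derivative[OF that] has_derivative_linear by blast
    show ?thesis
      using has_derivative_compose[OF 1 C_diff_Suc_has_derivative[OF that]]
      by (simp add: has_field_derivative_def linear_cmul[OF lin] mult.commute[of _ "frechet_derivative _ _ _"] mult_commute_abs)
  qed
  have "\<exists>s. 0 < s \<and> s < h \<and> g h - g 0 = (h - 0) * (?f' (u + s *\<^sub>R v + h *\<^sub>R w) v - ?f' (u + s *\<^sub>R v) v)"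
  proof (rule MVT2[OF assms(2)])
    fix s assume s: "0 \<le> s" "s \<le> h"
    have "((\<lambda>s. f ((u + h *\<^sub>R w) + s *\<^sub>R v)) has_real_derivative ?f' ((u + h *\<^sub>R w) + s *\<^sub>R v) v) (at s)"
      by (rule line[OF f1]) (use V[of s h] s assms(2) in \<open>simp add: algebra_simps\<close>)
    moreover have "((\<lambda>s. f (u + s *\<^sub>R v)) has_real_derivative ?f' (u + s *\<^sub>R v) v) (at s)"
      by (rule line[OF f1]) (use V[of s 0] s assms(2) in simp)
    ultimately show "(g has_real_derivative (?f' (u + s *\<^sub>R v + h *\<^sub>R w) v - ?f' (u + s *\<^sub>R v) v)) (at s)"
      unfolding g_def by (intro DERIV_diff) (simp_all add: algebra_simps)
  qed
  then obtain s where s: "0 < s" "s < h" "g h - g 0 = h * (?f' (u + s *\<^sub>R v + h *\<^sub>R w) v - ?f' (u + s *\<^sub>R v) v)"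
    by auto
  have "\<exists>t. 0 < t \<and> t < h \<and> ?f' (u + s *\<^sub>R v + h *\<^sub>R w) v - ?f' (u + s *\<^sub>R v + 0 *\<^sub>R w) v
      = (h - 0) * frechet_derivative (\<lambda>x. ?f' x v) (at (u + s *\<^sub>R v + t *\<^sub>R w)) w"
    by (rule MVT2[OF assms(2)], rule line[OF f2]) (use V s in auto)
  then obtain t where t: "0 < t" "t < h" "?f' (u + s *\<^sub>R v + h *\<^sub>R w) v - ?f' (u + s *\<^sub>R v) v
      = h * frechet_derivative (\<lambda>x. ?f' x v) (at (u + s *\<^sub>R v + t *\<^sub>R w)) w"
    by auto
  show thesis using that[OF s(1,2) t(1,2)] s(3) t(3) by (simp add: g_def algebra_simps)
qed

lemma mixed_difference_quotient_limit:
  fixes f :: "'a::euclidean_space \<Rightarrow> real"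
  assumes "C_diff 2 V f" "open V" "u \<in> V"
  shows "((\<lambda>h. (f (u + h *\<^sub>R v + h *\<^sub>R w) - f (u + h *\<^sub>R v) - f (u + h *\<^sub>R w) + f u) / (h * h)) \<longlongrightarrow>
      frechet_derivative (\<lambda>x. frechet_derivative f (at x) v) (at u) w) (at_right 0)"
proof (rule tendstoI)
  fix \<epsilon> :: real assume "\<epsilon> > 0"
  let ?H = "\<lambda>x. frechet_derivative (\<lambda>x. frechet_derivative f (at x) v) (at x) w"
  have "continuous_on V ?H" using assms(1) by (simp add: numeral_2_eq_2)
  then have "isCont ?H u" using assms continuous_on_eq_continuous_at by blast
  then obtain d where d: "d > 0" "\<And>x. dist x u < d \<Longrightarrow> dist (?H x) (?H u) < \<epsilon>"
    using \<open>\<epsilon> > 0\<close> unfolding continuous_at_eps_delta by metis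
  obtain d' where d': "d' > 0" "ball u d' \<subseteq> V" using assms openE by blast
  define r where "r = min d d'"
  \<comment> \<open>For h < b the parallelogram spanned by h v and h w lies within distance r of u;
    the summand 1 covers v = w = 0.\<close>
  define b where "b = r / (norm v + norm w + 1)"
  have pos: "norm v + norm w + 1 > 0" by (smt (verit) norm_ge_zero)
  have r: "r > 0" using d d' by (simp add: r_def)
  then have b: "b > 0" using pos by (simp add: b_def)
  have near: "dist (u + s *\<^sub>R v + t *\<^sub>R w) u < r"
    if "0 \<le> s" "s \<le> h" "0 \<le> t" "t \<le> h" "h < b" for s t h
  proof -
    have "dist (u + s *\<^sub>R v + t *\<^sub>R w) u = norm (s *\<^sub>R v + t *\<^sub>R w)" by (simp add: dist_norm algebra_simps)
    also have "\<dots> \<le> s * norm v + t * norm w" using that norm_triangle_ineq[of "s *\<^sub>R v" "t *\<^sub>R w"] by simp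
    also have "\<dots> \<le> h * norm v + h * norm w" using that by (intro add_mono mult_right_mono) auto
    also have "\<dots> \<le> h * (norm v + norm w + 1)" using that by (simp add: algebra_simps)
    also have "\<dots> < b * (norm v + norm w + 1)" using that pos by (intro mult_strict_right_mono) auto
    also have "\<dots> = r" using pos by (simp add: b_def)
    finally show ?thesis .
  qed
  have "dist ((f (u + h *\<^sub>R v + h *\<^sub>R w) - f (u + h *\<^sub>R v) - f (u + h *\<^sub>R w) + f u) / (h * h)) (?H u) < \<epsilon>"
    if h: "0 < h" "h < b" for h
  proof -
    have "u + s *\<^sub>R v + t *\<^sub>R w \<in> V" if "0 \<le> s" "s \<le> h" "0 \<le> t" "t \<le> h" for s t
      using near[OF that h(2)] d'(2) by (auto simp: r_def dist_commute)
    then obtain s t where st: "0 < s" "s < h" "0 < t" "t < h"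
      "f (u + h *\<^sub>R v + h *\<^sub>R w) - f (u + h *\<^sub>R v) - f (u + h *\<^sub>R w) + f u = h * h * ?H (u + s *\<^sub>R v + t *\<^sub>R w)"
      using mixed_difference_quotient[OF assms(1) h(1)] by blast
    have "dist (u + s *\<^sub>R v + t *\<^sub>R w) u < d" using near[of s h t] st h by (auto simp: r_def)
    then show ?thesis using d(2) st(5) h by simp
  qed
  then show "\<forall>\<^sub>F h in at_right 0. dist ((f (u + h *\<^sub>R v + h *\<^sub>R w) - f (u + h *\<^sub>R v) - f (u + h *\<^sub>R w) + f u) / (h * h)) (?H u) < \<epsilon>"
    using b eventually_at_right_less eventually_at_right by (metis (mono_tags, lifting))
qed

text \<open>The double difference quotient is symmetric in v and w, and both mixed derivatives are
  its limit.\<close>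

lemma second_derivative_symmetric_real:
  fixes f :: "'a::euclidean_space \<Rightarrow> real"
  assumes "C_diff 2 V f" "open V" "u \<in> V"
  shows "frechet_derivative (\<lambda>x. frechet_derivative f (at x) v) (at u) w
       = frechet_derivative (\<lambda>x. frechet_derivative f (at x) w) (at u) v"
proof -
  have "((\<lambda>h. (f (u + h *\<^sub>R v + h *\<^sub>R w) - f (u + h *\<^sub>R v) - f (u + h *\<^sub>R w) + f u) / (h * h)) \<longlongrightarrow>
      frechet_derivative (\<lambda>x. frechet_derivative f (at x) w) (at u) v) (at_right 0)"
    using mixed_difference_quotient_limit[OF assms, of w v] by (simp add: add_ac diff_diff_eq)
  then show ?thesis
    using tendsto_unique[OF _ mixed_difference_quotient_limit[OF assms, of v w]] by simp
qed

lemma second_derivative_symmetric: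
  fixes f :: "'a::euclidean_space \<Rightarrow> 'b::euclidean_space"
  assumes "C_diff 2 V f" "open V" "u \<in> V"
  shows "frechet_derivative (\<lambda>x. frechet_derivative f (at x) v) (at u) w
       = frechet_derivative (\<lambda>x. frechet_derivative f (at x) w) (at u) v"
proof (rule euclidean_eqI)
  fix b :: 'b assume "b \<in> Basis"
  let ?f' = "\<lambda>x. frechet_derivative f (at x)" and ?g = "\<lambda>x. f x \<bullet> b"
  have f1: "C_diff (Suc 1) V f" using assms(1) by (simp add: numeral_2_eq_2)
  have g2: "C_diff 2 V ?g"
    by (rule C_diff_linear_image[OF assms(2) bounded_linear_inner_left assms(1)])
  have D1: "frechet_derivative ?g (at x) v = ?f' x v \<bullet> b" if "x \<in> V" for x v
    using frechet_derivative_at[OF bounded_linear.has_derivative[OF bounded_linear_inner_left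
        C_diff_Suc_has_derivative[OF f1 that]], of b] by metis
  have "frechet_derivative (\<lambda>x. frechet_derivative ?g (at x) v) (at u) w
      = frechet_derivative (\<lambda>x. ?f' x v) (at u) w \<bullet> b" for v w
  proof -
    have "C_diff (Suc 0) V (\<lambda>x. ?f' x v)" using f1 by simp
    note frechet_derivative_at[OF bounded_linear.has_derivative[OF bounded_linear_inner_left
        C_diff_Suc_has_derivative[OF this assms(3)]], of b]
    moreover have "frechet_derivative (\<lambda>x. frechet_derivative ?g (at x) v) (at u)
        = frechet_derivative (\<lambda>x. ?f' x v \<bullet> b) (at u)"
      by (rule frechet_derivative_cong_open[OF assms(2,3)]) (rule D1)
    ultimately show ?thesis by metis
  qed
  then show "frechet_derivative (\<lambda>x. ?f' x v) (at u) w \<bullet> b = frechet_derivative (\<lambda>x. ?f' x w) (at u) v \<bullet> b"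
    using second_derivative_symmetric_real[OF g2 assms(2,3), of v w] by simp
qed

section \<open>Naturality of the exterior derivative\<close>

lemma ext_deriv_cong_open:
  assumes "open V" "u \<in> V" "\<And>x w. x \<in> V \<Longrightarrow> a x w = b x w"
  shows "ext_deriv a u v w = ext_deriv b u v w"
  using frechet_derivative_cong_open[OF assms(1,2), of "\<lambda>x. a x w" "\<lambda>x. b x w" for w] assms(3)
  by (simp add: ext_deriv_def)

text \<open>The product rule gives the derivative of \<open>a\<close> plus a term with second
  derivatives of \<open>F\<close>; the latter is symmetric in v and w and cancels. The expansion
  \<open>rep\<close> is needed because \<open>a\<close> is differentiated with its vector argument
  fixed, while the derivative of \<open>F\<close> varies with the point.\<close>

lemma ext_deriv_pullback:
  fixes F :: "'a::euclidean_space \<Rightarrow> 'b::euclidean_space"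
  assumes F: "C_diff 2 V F" "open V" "u \<in> V" "F ` V \<subseteq> O'" "open O'"
    and lin: "\<And>x. x \<in> O' \<Longrightarrow> linear (a x)"
    and diff: "\<And>x w. x \<in> O' \<Longrightarrow> (\<lambda>x. a x w) differentiable (at x)"
  shows "ext_deriv (\<lambda>x w. a (F x) (frechet_derivative F (at x) w)) u v w
       = ext_deriv a (F u) (frechet_derivative F (at u) v) (frechet_derivative F (at u) w)"
proof -
  let ?F' = "\<lambda>x. frechet_derivative F (at x)"
  have f1: "C_diff (Suc 1) V F" using F(1) by (simp add: numeral_2_eq_2)
  have rep: "a y q = (\<Sum>b\<in>Basis. (q \<bullet> b) * a y b)" if "y \<in> O'" for y q
    by (subst (1) euclidean_representation[symmetric, of q])
       (simp add: linear_sum[OF lin[OF that]] linear_cmul[OF lin[OF that]])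
  have Fu: "F u \<in> O'" using F by auto
  have da: "((\<lambda>y. a y b) has_derivative frechet_derivative (\<lambda>y. a y b) (at (F u))) (at (F u))" for b
    using diff[OF Fu] frechet_derivative_works by blast
  have D: "frechet_derivative (\<lambda>x. a (F x) (?F' x w)) (at u) v
      = frechet_derivative (\<lambda>y. a y (?F' u w)) (at (F u)) (?F' u v)
        + a (F u) (frechet_derivative (\<lambda>x. ?F' x w) (at u) v)" for v w
  proof -
    let ?G = "frechet_derivative (\<lambda>x. ?F' x w) (at u)"
    have dG: "((\<lambda>x. ?F' x w) has_derivative ?G) (at u)"
      using C_diff_Suc_has_derivative[of 0 V "\<lambda>x. ?F' x w"] f1 F(3) by simp
    have "((\<lambda>x. \<Sum>b\<in>Basis. (?F' x w \<bullet> b) * a (F x) b) has_derivative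
       (\<lambda>v. \<Sum>b\<in>Basis. (?F' u w \<bullet> b) * frechet_derivative (\<lambda>y. a y b) (at (F u)) (?F' u v) + (?G v \<bullet> b) * a (F u) b)) (at u)"
      by (intro has_derivative_sum has_derivative_mult bounded_linear.has_derivative[OF bounded_linear_inner_left dG]
          has_derivative_compose[OF C_diff_Suc_has_derivative[OF f1 F(3)] da])
    moreover have "(\<Sum>b\<in>Basis. (?F' x w \<bullet> b) * a (F x) b) = a (F x) (?F' x w)" if "x \<in> V" for x
      using rep that F(4) by (metis image_subset_iff)
    ultimately have 1: "((\<lambda>x. a (F x) (?F' x w)) has_derivative
       (\<lambda>v. \<Sum>b\<in>Basis. (?F' u w \<bullet> b) * frechet_derivative (\<lambda>y. a y b) (at (F u)) (?F' u v) + (?G v \<bullet> b) * a (F u) b)) (at u)"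
      by (rule has_derivative_transform_within_open[OF _ F(2,3)])
    have "((\<lambda>y. \<Sum>b\<in>Basis. (?F' u w \<bullet> b) * a y b) has_derivative
       (\<lambda>q. \<Sum>b\<in>Basis. (?F' u w \<bullet> b) * frechet_derivative (\<lambda>y. a y b) (at (F u)) q)) (at (F u))"
      by (intro has_derivative_sum has_derivative_mult_right da)
    then have 2: "frechet_derivative (\<lambda>y. \<Sum>b\<in>Basis. (?F' u w \<bullet> b) * a y b) (at (F u))
        = (\<lambda>q. \<Sum>b\<in>Basis. (?F' u w \<bullet> b) * frechet_derivative (\<lambda>y. a y b) (at (F u)) q)"
      by (rule frechet_derivative_at[symmetric])
    have 3: "frechet_derivative (\<lambda>y. \<Sum>b\<in>Basis. (?F' u w \<bullet> b) * a y b) (at (F u))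
        = frechet_derivative (\<lambda>y. a y (?F' u w)) (at (F u))"
      by (rule frechet_derivative_cong_open[OF F(5) Fu]) (simp add: rep[symmetric])
    show ?thesis
      using fun_cong[OF frechet_derivative_at[OF 1], of v] rep[OF Fu, of "?G v"]
      unfolding 2[unfolded 3] by (simp add: sum.distrib)
  qed
  show ?thesis
    unfolding ext_deriv_def D using second_derivative_symmetric[OF F(1-3), of v w] by simp
qed

section \<open>The circle as a smooth manifold\<close>

text \<open>For charts that are local inverses of a covering p, a local representation is thus
  composition with p. All charts of the circle and of \<open>Q\<close> have this form.\<close>

lemma inv_coord_cover:
  assumes "inj_on p W" "u \<in> W"
  shows "inv_coord (p ` W, the_inv_into W p) u = p u"
proof -
  have "inj_on (the_inv_into W p) (p ` W)" using assms(1) by (rule inj_on_the_inv_into)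
  moreover have "the_inv_into W p (p u) = u" using assms by (rule the_inv_into_f_f)
  ultimately show ?thesis using the_inv_into_f_f[of "the_inv_into W p" "p ` W" "p u"] assms(2)
    by (simp add: inv_coord_def)
qed

text \<open>The charts are all local inverses of the angle parametrization, in analogy with
  \<open>Q\<close>; a map from the circle can then be studied as a function of a real angle.\<close>

definition circle :: "(complex, real) mfd" where
  "circle = \<lparr> Top = top_of_set (sphere 0 1),
              Atlas = {(cis ` W, the_inv_into W cis) | W. open W \<and> inj_on cis W} \<rparr>"

lemma Top_circle [simp]: "Top circle = top_of_set (sphere 0 1)"
  by (simp add: circle_def)

lemma Atlas_circleE:
  assumes "c \<in> Atlas circle"
  obtains W where "open W" "inj_on cis W" "c = (cis ` W, the_inv_into W cis)"
  using assms by (auto simp: circle_def)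

lemma sphere_cis:
  assumes "x \<in> sphere 0 1" obtains t where "x = cis t"
proof (rule that)
  show "x = cis (Arg x)" using assms by (subst cis_Arg) (auto simp: sgn_div_norm)
qed

text \<open>The branch of the argument through t: \<open>Arg\<close> is continuous off the negative
  real axis, and w / cis t stays close to 1.\<close>

lemma cis_lift_near:
  assumes "open W" "t \<in> W"
  obtains T where "open T" "cis t \<in> T"
    "\<And>w. w \<in> T \<inter> sphere 0 1 \<Longrightarrow> t + Arg (w / cis t) \<in> W \<and> cis (t + Arg (w / cis t)) = w"
    "continuous_on T (\<lambda>w. t + Arg (w / cis t))"
proof -
  define U where "U = (\<lambda>w. w / cis t) -` (- \<real>\<^sub>\<le>\<^sub>0)"
  have U: "open U" "cis t \<in> U"
    unfolding U_def by (auto intro!: open_vimage continuous_intros)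
  have cont: "continuous_on U (\<lambda>w. t + Arg (w / cis t))"
    unfolding U_def
    by (intro continuous_intros continuous_on_compose2[of "- \<real>\<^sub>\<le>\<^sub>0" Arg] continuous_at_imp_continuous_on ballI continuous_at_Arg)
       auto
  have "open ((\<lambda>w. t + Arg (w / cis t)) -` W \<inter> U)"
    using cont U(1) assms(1) by (simp add: continuous_on_open_vimage)
  then show thesis
  proof (rule that)
    show "cis t \<in> (\<lambda>w. t + Arg (w / cis t)) -` W \<inter> U" using U assms(2) by simp
    show "continuous_on ((\<lambda>w. t + Arg (w / cis t)) -` W \<inter> U) (\<lambda>w. t + Arg (w / cis t))"
      using cont continuous_on_subset by blast
    fix w assume "w \<in> (\<lambda>w. t + Arg (w / cis t)) -` W \<inter> U \<inter> sphere 0 1"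
    then have w: "t + Arg (w / cis t) \<in> W" "norm w = 1" by auto
    then have "cis (Arg (w / cis t)) = w / cis t"
      by (subst cis_Arg) (auto simp: sgn_div_norm norm_divide)
    then have "cis (t + Arg (w / cis t)) = w" by (simp flip: cis_mult)
    with w show "t + Arg (w / cis t) \<in> W \<and> cis (t + Arg (w / cis t)) = w" by simp
  qed
qed

text \<open>On a general open \<open>W\<close> the inverse of \<open>cis\<close> need not be a
  single branch of the argument, so openness and continuity are checked near each point with the
  branch that passes through it.\<close>

lemma circle_chart_homeomorphism:
  assumes "open W" "inj_on cis W"
  shows "openin (top_of_set (sphere 0 1)) (cis ` W)"
    and "homeomorphic_map (top_of_set (cis ` W)) (top_of_set W) (the_inv_into W cis)"
proof -
  have *: "\<exists>T. open T \<and> cis t \<in> T \<and> T \<inter> sphere 0 1 \<subseteq> cis ` W \<and>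
      continuous_on (T \<inter> sphere 0 1) (the_inv_into W cis)" if t: "t \<in> W" for t
  proof -
    obtain T where T: "open T" "cis t \<in> T"
      "\<And>w. w \<in> T \<inter> sphere 0 1 \<Longrightarrow> t + Arg (w / cis t) \<in> W \<and> cis (t + Arg (w / cis t)) = w"
      "continuous_on T (\<lambda>w. t + Arg (w / cis t))"
      using cis_lift_near[OF assms(1) t] by blast
    have "the_inv_into W cis w = t + Arg (w / cis t)" if "w \<in> T \<inter> sphere 0 1" for w
      using T(3)[OF that] the_inv_into_f_f[OF assms(2)] by metis
    then have "continuous_on (T \<inter> sphere 0 1) (the_inv_into W cis)"
      using continuous_on_subset[OF T(4)] continuous_on_cong
      by (metis (no_types, lifting) inf_le1)
    moreover have "T \<inter> sphere 0 1 \<subseteq> cis ` W" using T(3) by (metis image_eqI subsetI)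
    ultimately show ?thesis using T(1,2) by blast
  qed
  show op: "openin (top_of_set (sphere 0 1)) (cis ` W)"
  proof (subst openin_subopen, clarify)
    fix t assume "t \<in> W"
    then obtain T where "open T" "cis t \<in> T" "T \<inter> sphere 0 1 \<subseteq> cis ` W" using * by metis
    then show "\<exists>T. openin (top_of_set (sphere 0 1)) T \<and> cis t \<in> T \<and> T \<subseteq> cis ` W"
      by (intro exI[of _ "sphere 0 1 \<inter> T"]) auto
  qed
  have "continuous_on (cis ` W) (the_inv_into W cis)"
    unfolding continuous_on_eq_continuous_within
  proof clarify
    fix t assume "t \<in> W"
    then obtain T where T: "open T" "cis t \<in> T" "continuous_on (T \<inter> sphere 0 1) (the_inv_into W cis)"
      using * by metis
    then have "continuous (at (cis t) within T \<inter> sphere 0 1) (the_inv_into W cis)"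
      by (simp add: continuous_on_eq_continuous_within)
    moreover have "at (cis t) within T \<inter> sphere 0 1 = at (cis t) within sphere 0 1"
      by (rule at_within_nhd[OF T(2,1)]) auto
    ultimately have "continuous (at (cis t) within sphere 0 1) (the_inv_into W cis)" by metis
    then show "continuous (at (cis t) within cis ` W) (the_inv_into W cis)"
      by (rule continuous_within_subset) auto
  qed
  moreover have "homeomorphic_maps (top_of_set (cis ` W)) (top_of_set W) (the_inv_into W cis) cis"
    if "continuous_on (cis ` W) (the_inv_into W cis)"
    using that assms(2)
    by (auto simp: homeomorphic_maps_def continuous_map_in_subtopology the_inv_into_f_f f_the_inv_into_f
        intro!: continuous_intros)
  ultimately show "homeomorphic_map (top_of_set (cis ` W)) (top_of_set W) (the_inv_into W cis)"
    using homeomorphic_map_maps by blast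
qed

lemma second_countable_euclidean: "second_countable (euclidean :: 'a::second_countable_topology topology)"
proof -
  obtain \<B> :: "'a set set" where "countable \<B>" "topological_basis \<B>" using ex_countable_basis by blast
  then show ?thesis
    unfolding second_countable_def by (metis open_openin topological_basisE topological_basis_open)
qed

lemma C_diff_translation: "C_diff k S (\<lambda>v::real. a + (v - b))"
proof -
  have "C_diff k UNIV (\<lambda>v. (a - b) + v)"
    by (rule C_diff_add[OF open_UNIV C_diff_const C_diff_bounded_linear[OF bounded_linear_ident]])
  then have "C_diff k UNIV (\<lambda>v. a + (v - b))" by (simp add: algebra_simps)
  then show ?thesis by (rule C_diff_subset) simp
qed

lemma smooth_manifold_circle: "smooth_manifold circle"
  unfolding smooth_manifold_def
proof (intro conjI ballI)
  show "Hausdorff_space (Top circle)" by (simp add: Hausdorff_space_subtopology)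
  show "second_countable (Top circle)"
    by (simp add: second_countable_subtopology second_countable_euclidean)
  have "w \<in> (\<Union>c\<in>Atlas circle. chart_dom c)" if w: "w \<in> sphere 0 1" for w
  proof -
    \<comment> \<open>Angles in an interval of length 2 differ by less than pi, so
      \<open>Arg\<close> recovers s - t from \<open>cis (s - t)\<close>.\<close>
    have "inj_on cis {Arg w - 1 <..< Arg w + 1}"
    proof (rule inj_onI)
      fix s t assume st: "s \<in> {Arg w - 1 <..< Arg w + 1}" "t \<in> {Arg w - 1 <..< Arg w + 1}" "cis s = cis t"
      then have "cis (s - t) = 1" by (simp flip: cis_divide)
      then have "Arg (cis (s - t)) = 0" by simp
      moreover have "Arg (cis (s - t)) = s - t"
        using st pi_ge_two by (intro cis_Arg_unique) auto
      ultimately show "s = t" by simp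
    qed
    moreover have "w = cis (Arg w)" using w by (subst cis_Arg) (auto simp: sgn_div_norm)
    moreover have "Arg w \<in> {Arg w - 1 <..< Arg w + 1}" by simp
    ultimately have "w \<in> cis ` {Arg w - 1 <..< Arg w + 1}"
      "(cis ` {Arg w - 1 <..< Arg w + 1}, the_inv_into {Arg w - 1 <..< Arg w + 1} cis) \<in> Atlas circle"
      by (metis image_eqI) (use \<open>inj_on cis _\<close> open_greaterThanLessThan in \<open>unfold circle_def, simp, blast\<close>)
    then show ?thesis by force
  qed
  then show "(\<Union>c\<in>Atlas circle. chart_dom c) = topspace (Top circle)"
    by (auto elim!: Atlas_circleE)
next
  fix c assume "c \<in> Atlas circle"
  then obtain W where W: "open W" "inj_on cis W" "c = (cis ` W, the_inv_into W cis)" by (rule Atlas_circleE)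
  then have sub: "sphere 0 1 \<inter> cis ` W = cis ` W" by auto
  show "openin (Top circle) (chart_dom c)" using circle_chart_homeomorphism[OF W(1,2)] W(3) by simp
  show "open (chart_ran c)" using W by simp
  show "homeomorphic_map (subtopology (Top circle) (chart_dom c)) (top_of_set (chart_ran c)) (coord c)"
    using circle_chart_homeomorphism[OF W(1,2)] W(2,3) by (simp add: subtopology_subtopology sub)
next
  fix c d assume "c \<in> Atlas circle" "d \<in> Atlas circle"
  then obtain W W' where W: "open W" "inj_on cis W" "c = (cis ` W, the_inv_into W cis)"
    and W': "open W'" "inj_on cis W'" "d = (cis ` W', the_inv_into W' cis)"
    by (metis Atlas_circleE)
  show "smooth_on (coord c ` (chart_dom c \<inter> chart_dom d)) (local_rep c id d)"
    unfolding smooth_on_def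
  proof
    fix u assume "u \<in> coord c ` (chart_dom c \<inter> chart_dom d)"
    then obtain t u' where u': "u = the_inv_into W cis (cis t)" "t \<in> W" "u' \<in> W'" "cis t = cis u'"
      using W W' by (smt (verit, best) Int_iff fst_conv imageE snd_conv)
    then have u: "u \<in> W" "cis u = cis u'" using the_inv_into_f_f[OF W(2) u'(2)] by metis+
    \<comment> \<open>Two local inverses of \<open>cis\<close> differ locally by a constant multiple
      of 2 pi, here u' - u; the transition map is this translation wherever the translate lies in
      W'.\<close>
    let ?g = "\<lambda>v. u' + (v - u)"
    have "local_rep c id d v = ?g v"
      if "v \<in> coord c ` (chart_dom c \<inter> chart_dom d) \<inter> ?g -` W'" for v
    proof -
      have v: "v \<in> W" "?g v \<in> W'" using that W the_inv_into_into[OF W(2), of _ W] by auto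
      have "cis (?g v) = cis v" using u(2) by (simp flip: cis_mult cis_divide)
      then show ?thesis
        using v W W' the_inv_into_f_f[OF W'(2) v(2)] by (simp add: local_rep_def inv_coord_cover)
    qed
    then show "\<exists>U g. open U \<and> u \<in> U \<and> (\<forall>k. C_diff k U g)
        \<and> (\<forall>y\<in>coord c ` (chart_dom c \<inter> chart_dom d) \<inter> U. g y = local_rep c id d y)"
      using u u'(3) W'(1) by (intro exI[of _ "?g -` W'"] exI[of _ ?g])
        (auto intro!: open_vimage continuous_intros C_diff_translation)
  qed
qed

lemma compact_space_circle: "compact_space (Top circle)"
  by (simp add: compact_space_subtopology)

section \<open>Coordinates on an embedded copy of \<open>Q(a)\<close>\<close>

lemma Top_Q [simp]: "Top (Q a) = top_of_set (sphere 0 1 \<times> area_disk a)"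
  by (simp add: Q_def)

lemma open_area_disk: "open (area_disk a)"
  unfolding area_disk_def by (intro open_Collect_less continuous_intros)

lemma area_disk_mono: "a \<le> b \<Longrightarrow> area_disk a \<subseteq> area_disk b"
  by (auto simp: area_disk_def)

lemma Q_form_eq: "Q_form c u v = fst v - lam (snd u) (snd v)"
  by (simp add: Q_form_def split_beta)

lemma Q_cover_surj:
  assumes "q \<in> sphere 0 1 \<times> area_disk a"
  obtains u where "u \<in> UNIV \<times> area_disk a" "Q_cover u = q"
proof (rule that)
  have "cis (Arg (fst q)) = fst q" using assms by (subst cis_Arg) (auto simp: sgn_div_norm)
  then show "Q_cover (Arg (fst q) / (2 * pi), snd q) = q" by (simp add: Q_cover_def prod_eq_iff)
qed (use assms in auto)

lemma Q_cover_in: "u \<in> UNIV \<times> area_disk a \<Longrightarrow> Q_cover u \<in> sphere 0 1 \<times> area_disk a"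
  by (auto simp: Q_cover_def)

lemma Q_chart_at:
  assumes "u \<in> UNIV \<times> area_disk a"
  obtains W where "open W" "u \<in> W" "W \<subseteq> UNIV \<times> area_disk a" "inj_on Q_cover W"
    "(Q_cover ` W, the_inv_into W Q_cover) \<in> Atlas (Q a)"
proof -
  \<comment> \<open>The width 1/2 in t is an angle of pi, so that \<open>Arg\<close> separates any
    two points of the strip.\<close>
  let ?W = "{fst u - 1/4 <..< fst u + 1/4} \<times> area_disk a"
  have W: "open ?W" by (intro open_Times open_area_disk) simp
  have inj: "inj_on Q_cover ?W"
  proof (rule inj_onI)
    fix x y assume xy: "x \<in> ?W" "y \<in> ?W" "Q_cover x = Q_cover y"
    then have eq: "cis (2 * pi * fst x) = cis (2 * pi * fst y)" "snd x = snd y"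
      by (simp_all add: Q_cover_def split_beta)
    have "cis (2 * pi * (fst x - fst y)) = cis (2 * pi * fst x) / cis (2 * pi * fst y)"
      by (simp add: cis_divide right_diff_distrib)
    then have "cis (2 * pi * (fst x - fst y)) = 1" using eq(1) by simp
    then have "Arg (cis (2 * pi * (fst x - fst y))) = 0" by simp
    moreover have "Arg (cis (2 * pi * (fst x - fst y))) = 2 * pi * (fst x - fst y)"
    proof (rule cis_Arg_unique)
      have "fst u - 1/4 < fst x" "fst x < fst u + 1/4" "fst u - 1/4 < fst y" "fst y < fst u + 1/4"
        using xy(1,2) by auto
      then have "\<bar>fst x - fst y\<bar> < 1/2" by linarith
      then have "2 * pi * \<bar>fst x - fst y\<bar> < pi" by simp
      then have "\<bar>2 * pi * (fst x - fst y)\<bar> < pi" by (simp add: abs_mult)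
      then show "- pi < 2 * pi * (fst x - fst y)" "2 * pi * (fst x - fst y) \<le> pi" by linarith+
    qed simp
    ultimately show "x = y" using eq(2) by (simp add: prod_eq_iff)
  qed
  have "?W \<subseteq> UNIV \<times> area_disk a" by auto
  moreover have "u \<in> ?W" using assms by (auto simp: mem_Times_iff)
  ultimately show thesis using that[of ?W] W inj by (auto simp: Q_def)
qed

section \<open>The embedded copy of \<open>Q(1 + \<epsilon>)\<close> in Y and its lift to the
  cover\<close>

locale contact_cylinder =
  fixes Y :: "('y, real^3) mfd" and \<xi> :: "('y, real^3) tangent_field"
    and \<alpha> :: "('y, real^3) form" and e :: "complex \<times> complex \<Rightarrow> 'y" and \<epsilon> \<epsilon>' :: real
  assumes Y: "smooth_manifold Y"
    and emb: "contact_embedding (Q (1 + \<epsilon>)) (ker_form Q_form) Y \<xi> e"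
    and eps: "\<epsilon>' < \<epsilon>"
    and form: "contact_form_for Y \<xi> \<alpha>"
    and pull: "pulls_back_on (topspace (Top (Q (1 + \<epsilon>')))) (Q (1 + \<epsilon>)) Y e \<alpha> Q_form"
begin

text \<open>Curves are written on the cover, an open subset of a vector space where dt - \<lambda>
  has one formula throughout. \<open>E\<close> is only locally injective.\<close>

definition E :: "real \<times> complex \<Rightarrow> 'y" where "E u = e (Q_cover u)"

abbreviation "D \<equiv> UNIV \<times> area_disk (1 + \<epsilon>)"
abbreviation "D' \<equiv> UNIV \<times> area_disk (1 + \<epsilon>')"

lemma D'_subset: "D' \<subseteq> D"
  using area_disk_mono[of "1 + \<epsilon>'" "1 + \<epsilon>"] eps by auto

lemma open_D: "open D" "open D'"
  by (intro open_Times open_UNIV open_area_disk)+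

lemma e_continuous: "continuous_map (top_of_set (sphere 0 1 \<times> area_disk (1 + \<epsilon>))) (Top Y) e"
  using emb by (simp add: contact_embedding_def smooth_embedding_def immersion_def smooth_map_def)

lemma e_inj: "inj_on e (sphere 0 1 \<times> area_disk (1 + \<epsilon>))"
  using emb homeomorphic_imp_injective_map
  by (force simp: contact_embedding_def smooth_embedding_def embedding_map_def)

lemma Hausdorff_Y: "Hausdorff_space (Top Y)"
  using Y by (simp add: smooth_manifold_def)

lemma chart_Y:
  assumes "d \<in> Atlas Y"
  shows "openin (Top Y) (chart_dom d)" "open (chart_ran d)" "inj_on (coord d) (chart_dom d)"
    "continuous_map (subtopology (Top Y) (chart_dom d)) euclidean (coord d)"
proof -
  have h: "homeomorphic_map (subtopology (Top Y) (chart_dom d)) (top_of_set (chart_ran d)) (coord d)"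
    and op: "openin (Top Y) (chart_dom d)" "open (chart_ran d)"
    using Y assms by (auto simp: smooth_manifold_def)
  have "topspace (Top Y) \<inter> chart_dom d = chart_dom d" using openin_subset[OF op(1)] by blast
  then show "inj_on (coord d) (chart_dom d)"
    using homeomorphic_imp_injective_map[OF h] by simp
  show "continuous_map (subtopology (Top Y) (chart_dom d)) euclidean (coord d)"
    using homeomorphic_imp_continuous_map[OF h] continuous_map_in_subtopology by blast
qed (use Y assms in \<open>auto simp: smooth_manifold_def\<close>)

lemma chart_Y_at:
  assumes "y \<in> topspace (Top Y)"
  obtains d where "d \<in> Atlas Y" "y \<in> chart_dom d"
proof -
  have "y \<in> (\<Union>d\<in>Atlas Y. chart_dom d)" using assms Y by (simp add: smooth_manifold_def)
  then show thesis using that by blast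
qed

lemma E_continuous: "continuous_map (top_of_set D) (Top Y) E"
  unfolding E_def
  by (rule continuous_map_compose[OF _ e_continuous, unfolded o_def])
     (auto simp: continuous_map_in_subtopology Q_cover_def split_beta intro!: continuous_intros)

lemma E_in_Y: "u \<in> D \<Longrightarrow> E u \<in> topspace (Top Y)"
  using continuous_map_image_subset_topspace[OF E_continuous] by auto

lemma open_E_vimage:
  assumes "openin (Top Y) S" shows "open {u \<in> D. E u \<in> S}"
proof -
  have "openin (top_of_set D) {u \<in> D. E u \<in> S}"
    using openin_continuous_map_preimage[OF E_continuous assms] by simp
  then show ?thesis using openin_open_trans open_D(1) by blast
qed

text \<open>In a chart of \<open>Q\<close> inverse to \<open>Q_cover\<close>, the chart expression
  of \<open>E\<close> is the local representation of \<open>e\<close>, so the conditions on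
  \<open>e\<close> become statements of ordinary calculus. The contact condition holds on all of V;
  the identity of forms holds over \<open>D'\<close> only.\<close>

lemma E_coordinates:
  assumes u: "u \<in> D" and d: "d \<in> Atlas Y" and Eu: "E u \<in> chart_dom d"
  obtains V where "open V" "u \<in> V" "V \<subseteq> D" "E ` V \<subseteq> chart_dom d"
    "inj_on (\<lambda>x. coord d (E x)) V" "\<And>k. C_diff k V (\<lambda>x. coord d (E x))"
    "\<And>x. x \<in> V \<Longrightarrow> inj (frechet_derivative (\<lambda>x. coord d (E x)) (at x))"
    "\<And>x v. x \<in> V \<Longrightarrow> fst v = lam (snd x) (snd v) \<Longrightarrow>
       frechet_derivative (\<lambda>x. coord d (E x)) (at x) v \<in> \<xi> d (coord d (E x))"
    "\<And>x v. x \<in> V \<Longrightarrow> x \<in> D' \<Longrightarrow>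
       \<alpha> d (coord d (E x)) (frechet_derivative (\<lambda>x. coord d (E x)) (at x) v) = fst v - lam (snd x) (snd v)"
proof -
  let ?F = "\<lambda>x. coord d (E x)"
  obtain W where W: "open W" "u \<in> W" "W \<subseteq> D" "inj_on Q_cover W"
    "(Q_cover ` W, the_inv_into W Q_cover) \<in> Atlas (Q (1 + \<epsilon>))"
    using Q_chart_at[OF u] .
  define c where "c = (Q_cover ` W, the_inv_into W Q_cover)"
  have c: "c \<in> Atlas (Q (1 + \<epsilon>))" "chart_dom c = Q_cover ` W"
    "\<And>x. x \<in> W \<Longrightarrow> coord c (Q_cover x) = x"
    using W by (auto simp: c_def the_inv_into_f_f)
  define S where "S = {x \<in> D. E x \<in> chart_dom d} \<inter> W"
  have S: "open S" unfolding S_def using open_E_vimage chart_Y(1)[OF d] W(1) by blast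
  have "coord c ` (chart_dom c \<inter> e -` chart_dom d) = S"
  proof
    show "coord c ` (chart_dom c \<inter> e -` chart_dom d) \<subseteq> S"
      using c W(3) by (auto simp: S_def E_def)
    show "S \<subseteq> coord c ` (chart_dom c \<inter> e -` chart_dom d)"
    proof
      fix x assume "x \<in> S"
      then show "x \<in> coord c ` (chart_dom c \<inter> e -` chart_dom d)"
        using c by (intro image_eqI[where x = "Q_cover x"]) (auto simp: S_def E_def)
    qed
  qed
  then have "smooth_on S (local_rep c e d)"
    using emb c(1) d by (auto simp: contact_embedding_def smooth_embedding_def immersion_def smooth_map_def)
  moreover have "u \<in> S" using u W Eu by (simp add: S_def)
  ultimately obtain V where V: "open V" "u \<in> V" "V \<subseteq> S" "\<And>k. C_diff k V (local_rep c e d)"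
    using smooth_on_open_C_diff[OF S] by blast
  have rep: "local_rep c e d x = ?F x" if "x \<in> W" for x
    using inv_coord_cover[OF W(4) that] by (simp add: local_rep_def c_def E_def)
  have diff: "differential c e d (Q_cover x) = frechet_derivative ?F (at x)" if "x \<in> W" for x
    unfolding differential_def c(3)[OF that]
    by (rule frechet_derivative_cong_open[OF W(1) that]) (rule rep)
  have dom: "Q_cover x \<in> chart_dom c" "e (Q_cover x) \<in> chart_dom d" "x \<in> W" if "x \<in> V" for x
    using that V(3) c(2) by (auto simp: S_def E_def)
  show thesis
  proof (rule that[OF V(1,2)])
    show "V \<subseteq> D" "E ` V \<subseteq> chart_dom d" using V(3) by (auto simp: S_def)
    show "inj_on ?F V"
    proof (rule inj_onI)
      fix x y assume xy: "x \<in> V" "y \<in> V" "?F x = ?F y"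
      then have "e (Q_cover x) = e (Q_cover y)"
        using inj_onD[OF chart_Y(3)[OF d]] dom by (simp add: E_def)
      moreover have "Q_cover x \<in> sphere 0 1 \<times> area_disk (1 + \<epsilon>)" if "x \<in> V" for x
        using that V(3) by (intro Q_cover_in) (auto simp: S_def)
      ultimately have "Q_cover x = Q_cover y" using inj_onD[OF e_inj] xy(1,2) by metis
      then show "x = y" using inj_onD[OF W(4)] dom xy by blast
    qed
    show "C_diff k V ?F" for k
      by (rule C_diff_cong_imp[OF V(1) _ V(4)]) (use V(3) rep in \<open>auto simp: S_def\<close>)
    fix x assume x: "x \<in> V"
    note x' = dom[OF x]
    show "inj (frechet_derivative ?F (at x))"
      using emb c(1) d x' unfolding contact_embedding_def smooth_embedding_def immersion_def
      by (metis diff)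
    have "frechet_derivative ?F (at x) ` ker_form Q_form c x = \<xi> d (?F x)"
      using emb c(1) d x' unfolding contact_embedding_def
      by (metis diff c(3) E_def)
    then show "frechet_derivative ?F (at x) v \<in> \<xi> d (?F x)" if "fst v = lam (snd x) (snd v)" for v
      using that by (auto simp: ker_form_def Q_form_eq)
    show "\<alpha> d (?F x) (frechet_derivative ?F (at x) v) = fst v - lam (snd x) (snd v)" if "x \<in> D'" for v
    proof -
      have "Q_cover x \<in> chart_dom c \<inter> topspace (Top (Q (1 + \<epsilon>')))"
        using x'(1) Q_cover_in[OF that] by simp
      then have "\<alpha> d (coord d (e (Q_cover x))) (differential c e d (Q_cover x) v) = Q_form c (coord c (Q_cover x)) v"
        using pull c(1) d x'(2) unfolding pulls_back_on_def by blast
      then show ?thesis using diff[OF x'(3)] c(3)[OF x'(3)] by (simp add: E_def Q_form_eq)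
    qed
  qed
qed

section \<open>Curves and families in Y that are given on the cover\<close>

lemma E_compose_C_diff:
  fixes H :: "'x::euclidean_space \<Rightarrow> real \<times> complex"
  assumes "open A" "\<And>k. C_diff k A H" "x \<in> A" "H x \<in> D" "d \<in> Atlas Y" "E (H x) \<in> chart_dom d"
  obtains U where "open U" "x \<in> U" "U \<subseteq> A" "\<And>k. C_diff k U (\<lambda>x. coord d (E (H x)))"
proof -
  obtain V where V: "open V" "H x \<in> V" "\<And>k. C_diff k V (\<lambda>x. coord d (E x))"
    using E_coordinates[OF assms(4-6)] by metis
  have "continuous_on A H" using C_diff_imp_continuous_on assms(2) by blast
  then have op: "open (A \<inter> H -` V)" using continuous_open_preimage assms(1) V(1) by blast
  show thesis
    by (rule that[OF op _ _ C_diff_compose[OF op V(3) C_diff_subset[OF assms(2)]]]) (use assms V in auto)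
qed

lemma E_compose_has_vector_derivative:
  assumes "H t \<in> D" "d \<in> Atlas Y" "E (H t) \<in> chart_dom d" "(H has_vector_derivative h) (at t)"
  shows "((\<lambda>t. coord d (E (H t))) has_vector_derivative frechet_derivative (\<lambda>x. coord d (E x)) (at (H t)) h) (at t)"
proof -
  obtain V where V: "H t \<in> V" "\<And>k. C_diff k V (\<lambda>x. coord d (E x))"
    using E_coordinates[OF assms(1-3)] by metis
  note D = C_diff_Suc_has_derivative[OF V(2) V(1)]
  show ?thesis
    using has_derivative_compose[OF assms(4)[unfolded has_vector_derivative_def] D]
    by (simp add: has_vector_derivative_def linear_cmul[OF has_derivative_linear[OF D]])
qed

text \<open>The angle parametrization turns immersed and Legendrian into conditions on the velocity
  of H: nonzero, and annihilated by dt - \<lambda>. H need not be periodic, only \<open>E\<close>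
  composed with H; this allows the t-coordinate to grow by 1 around the circle.\<close>

lemma legendrian_immersion_E:
  assumes f: "continuous_map (Top circle) (Top Y) f" "\<And>t. f (cis t) = E (H t)"
    and H: "\<And>k. C_diff k UNIV H" "\<And>t. H t \<in> D"
    and H': "\<And>t. (H has_vector_derivative H' t) (at t)" "\<And>t. H' t \<noteq> 0"
    and leg: "\<And>t. fst (H' t) = lam (snd (H t)) (snd (H' t))"
  shows "legendrian_immersion circle Y \<xi> f"
proof -
  let ?F = "\<lambda>d x. coord d (E x)"
  have rep: "local_rep c f d u = ?F d (H u)"
    if "inj_on cis W" "c = (cis ` W, the_inv_into W cis)" "u \<in> W" for c W d u
    using inv_coord_cover[OF that(1,3)] that(2) f(2) by (simp add: local_rep_def)
  have dif: "differential c f d (cis t) = (\<lambda>v. v *\<^sub>R frechet_derivative (?F d) (at (H t)) (H' t))"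
    if "open W" "inj_on cis W" "c = (cis ` W, the_inv_into W cis)" "t \<in> W" "d \<in> Atlas Y" "E (H t) \<in> chart_dom d"
    for c W d t
  proof -
    have "frechet_derivative (local_rep c f d) (at t) = frechet_derivative (\<lambda>u. ?F d (H u)) (at t)"
      by (rule frechet_derivative_cong_open[OF that(1,4)]) (rule rep[OF that(2,3)])
    also have "\<dots> = (\<lambda>v. v *\<^sub>R frechet_derivative (?F d) (at (H t)) (H' t))"
      using E_compose_has_vector_derivative[OF H(2) that(5,6) H'(1)]
      unfolding has_vector_derivative_def by (rule frechet_derivative_at[symmetric])
    finally show ?thesis using that(2-4) by (simp add: differential_def the_inv_into_f_f)
  qed
  show ?thesis
    unfolding legendrian_immersion_def immersion_def smooth_map_def
  proof (intro conjI ballI impI)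
    show "continuous_map (Top circle) (Top Y) f" by (rule f(1))
  next
    fix c d assume c: "c \<in> Atlas circle" and d: "d \<in> Atlas Y"
    obtain W where W: "open W" "inj_on cis W" "c = (cis ` W, the_inv_into W cis)"
      using Atlas_circleE[OF c] .
    show "smooth_on (coord c ` (chart_dom c \<inter> f -` chart_dom d)) (local_rep c f d)"
    proof (rule smooth_onI)
      fix u assume "u \<in> coord c ` (chart_dom c \<inter> f -` chart_dom d)"
      then have u: "u \<in> W" "E (H u) \<in> chart_dom d" using W f(2) by (auto simp: the_inv_into_f_f)
      obtain U where U: "open U" "u \<in> U" "U \<subseteq> W" "\<And>k. C_diff k U (\<lambda>x. coord d (E (H x)))"
        using E_compose_C_diff[OF W(1) C_diff_subset[OF H(1)] u(1) H(2) d u(2)] by auto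
      have "coord d (E (H y)) = local_rep c f d y" if "y \<in> U" for y
        using rep[OF W(2,3), of y d] U(3) that by auto
      with U show "\<exists>U g. open U \<and> u \<in> U \<and> (\<forall>k. C_diff k U g)
          \<and> (\<forall>y\<in>coord c ` (chart_dom c \<inter> f -` chart_dom d) \<inter> U. g y = local_rep c f d y)"
        by blast
    qed
  next
    fix c d p assume c: "c \<in> Atlas circle" and d: "d \<in> Atlas Y" and p: "p \<in> chart_dom c" "f p \<in> chart_dom d"
    obtain W where W: "open W" "inj_on cis W" "c = (cis ` W, the_inv_into W cis)"
      using Atlas_circleE[OF c] .
    obtain t where t: "t \<in> W" "p = cis t" using p(1) W(3) by auto
    have Et: "E (H t) \<in> chart_dom d" using p(2) t f(2) by simp
    note dp = dif[OF W t(1) d Et, folded t(2)]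
    obtain V where V: "H t \<in> V" "\<And>k. C_diff k V (?F d)"
      "inj (frechet_derivative (?F d) (at (H t)))"
      "\<And>v. fst v = lam (snd (H t)) (snd v) \<Longrightarrow> frechet_derivative (?F d) (at (H t)) v \<in> \<xi> d (?F d (H t))"
      using E_coordinates[OF H(2) d Et] by metis
    have lin: "linear (frechet_derivative (?F d) (at (H t)))"
      using has_derivative_linear[OF C_diff_Suc_has_derivative[OF V(2,1)]] .
    have nz: "frechet_derivative (?F d) (at (H t)) (H' t) \<noteq> 0"
      using linear_injective_0[OF lin] V(3) H'(2) by blast
    show "inj (differential c f d p)"
      unfolding dp using nz by (auto intro: injI)
    show "range (differential c f d p) \<subseteq> \<xi> d (coord d (f p))"
    proof clarify
      fix v
      have "lam (snd (H t)) (snd (v *\<^sub>R H' t)) = v * lam (snd (H t)) (snd (H' t))"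
        by (simp add: lam_def algebra_simps)
      then have "frechet_derivative (?F d) (at (H t)) (v *\<^sub>R H' t) \<in> \<xi> d (?F d (H t))"
        by (intro V(4)) (simp add: leg)
      then show "differential c f d p v \<in> \<xi> d (coord d (f p))"
        using f(2)[of t, folded t(2)] by (simp add: dp linear_cmul[OF lin])
    qed
  qed
qed

lemma homotopy_speed_E:
  assumes "\<And>s. i s x = E (H s)" "t \<in> {0..1}" "H t \<in> D'" "(H has_vector_derivative h) (at t)"
  shows "homotopy_speed Y \<alpha> i t x = fst h - lam (snd (H t)) (snd h)"
proof -
  have HD: "H t \<in> D" using D'_subset assms(3) by (rule subsetD)
  define d where "d = (SOME d. d \<in> Atlas Y \<and> i t x \<in> chart_dom d)"
  have "\<exists>d. d \<in> Atlas Y \<and> i t x \<in> chart_dom d"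
    using chart_Y_at[OF E_in_Y[OF HD]] assms(1) by metis
  then have d: "d \<in> Atlas Y" "E (H t) \<in> chart_dom d"
    using someI_ex[of "\<lambda>d. d \<in> Atlas Y \<and> i t x \<in> chart_dom d"] assms(1) by (auto simp: d_def)
  obtain V where V: "H t \<in> V" "\<And>v. H t \<in> D' \<Longrightarrow>
     \<alpha> d (coord d (E (H t))) (frechet_derivative (\<lambda>x. coord d (E x)) (at (H t)) v) = fst v - lam (snd (H t)) (snd v)"
    using E_coordinates[OF HD d] by metis
  \<comment> \<open>H has a two-sided derivative even at the times 0 and 1, so restricting to
    \<open>{0..1}\<close> does not change it.\<close>
  have "vector_derivative (\<lambda>s. coord d (E (H s))) (at t within {0..1})
      = frechet_derivative (\<lambda>x. coord d (E x)) (at (H t)) h"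
    using has_vector_derivative_at_within[OF E_compose_has_vector_derivative[OF HD d assms(4)]] assms(2)
    by (intro vector_derivative_within_closed_interval) auto
  then show ?thesis
    using V(2)[OF assms(3)] by (simp add: homotopy_speed_def Let_def d_def assms(1))
qed

section \<open>Reeb trajectories in the embedded copy\<close>

text \<open>Source and target both have dimension 3, so invariance of domain applies to the
  injective chart expressions.\<close>

lemma openin_E_image:
  assumes "open S" "S \<subseteq> D"
  shows "openin (Top Y) (E ` S)"
proof (subst openin_subopen, clarify)
  fix t z assume u: "(t, z) \<in> S"
  then have uD: "(t, z) \<in> D" using assms(2) by (rule rev_subsetD)
  obtain d where d: "d \<in> Atlas Y" "E (t, z) \<in> chart_dom d" using chart_Y_at[OF E_in_Y[OF uD]] .
  obtain V where V: "open V" "(t, z) \<in> V" "E ` V \<subseteq> chart_dom d"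
    "inj_on (\<lambda>x. coord d (E x)) V" "\<And>k. C_diff k V (\<lambda>x. coord d (E x))"
    using E_coordinates[OF uD d] by metis
  let ?N = "(\<lambda>x. coord d (E x)) ` (V \<inter> S)"
  have "open ?N"
  proof (rule invariance_of_domain_gen)
    show "continuous_on (V \<inter> S) (\<lambda>x. coord d (E x))"
      using C_diff_imp_continuous_on[OF V(5)] by (rule continuous_on_subset) simp
    show "inj_on (\<lambda>x. coord d (E x)) (V \<inter> S)" using V(4) by (rule inj_on_subset) simp
  qed (use V(1) assms(1) in auto)
  then have "openin (subtopology (Top Y) (chart_dom d)) {y \<in> topspace (subtopology (Top Y) (chart_dom d)). coord d y \<in> ?N}"
    using openin_continuous_map_preimage[OF chart_Y(4)[OF d(1)]] by simp
  then have "openin (Top Y) {y \<in> topspace (subtopology (Top Y) (chart_dom d)). coord d y \<in> ?N}"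
    by (rule openin_trans_full[OF _ chart_Y(1)[OF d(1)]])
  moreover have "{y \<in> topspace (subtopology (Top Y) (chart_dom d)). coord d y \<in> ?N} = E ` (V \<inter> S)"
  proof -
    have "E ` (V \<inter> S) \<subseteq> topspace (Top Y)" using E_in_Y assms(2) by blast
    then show ?thesis using inj_onD[OF chart_Y(3)[OF d(1)]] V(3) by (auto simp: image_subset_iff) blast
  qed
  ultimately show "\<exists>T. openin (Top Y) T \<and> E (t, z) \<in> T \<and> T \<subseteq> E ` S"
    using u V(2) by (metis (no_types, lifting) IntI Int_lower2 image_eqI image_mono)
qed

text \<open>The projection of the embedded copy to the disk, as a function on Y; outside the copy
  its value is meaningless. It is defined through \<open>e\<close> because \<open>E\<close> has no
  inverse.\<close>

definition disk_coord :: "'y \<Rightarrow> complex" where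
  "disk_coord y = snd (the_inv_into (sphere 0 1 \<times> area_disk (1 + \<epsilon>)) e y)"

lemma disk_coord_E: "u \<in> D \<Longrightarrow> disk_coord (E u) = snd u"
  using the_inv_into_f_f[OF e_inj Q_cover_in] by (simp add: disk_coord_def E_def Q_cover_def split_beta)

text \<open>As a bilinear form \<open>lam\<close> is half the determinant, so d\<lambda> = 2
  \<open>lam\<close> is the area form.\<close>

lemma ext_deriv_standard: "ext_deriv (\<lambda>x w. fst w - lam (snd x) (snd w)) u v w = - 2 * lam (snd v) (snd w)"
proof -
  have "frechet_derivative (\<lambda>x. fst w - lam (snd x) (snd w)) (at u) v = - lam (snd v) (snd w)"
    for u v w :: "real \<times> complex"
  proof -
    have "((\<lambda>x. fst w - lam (snd x) (snd w)) has_derivative (\<lambda>v. - lam (snd v) (snd w))) (at u)"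
      unfolding lam_def by (auto intro!: derivative_eq_intros simp: field_simps)
    then show ?thesis using fun_cong[OF frechet_derivative_at] by metis
  qed
  moreover have "lam (snd w) (snd v) = - lam (snd v) (snd w)" by (simp add: lam_def field_simps)
  ultimately show ?thesis by (simp add: ext_deriv_def)
qed

text \<open>The Reeb field of \<open>dt - \<lambda>\<close> is \<open>\<partial>\<^sub>t\<close>.\<close>

lemma reeb_vector_E:
  assumes u: "u \<in> D'" and d: "d \<in> Atlas Y" "E u \<in> chart_dom d"
    and v: "reeb_vector (\<alpha> d) (coord d (E u)) (frechet_derivative (\<lambda>x. coord d (E x)) (at u) v)"
  shows "snd v = 0"
proof -
  let ?F = "\<lambda>x. coord d (E x)"
  have uD: "u \<in> D" using D'_subset u by (rule subsetD)
  obtain V where V: "open V" "u \<in> V" "E ` V \<subseteq> chart_dom d" "\<And>k. C_diff k V ?F"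
    "\<And>x v. x \<in> V \<Longrightarrow> x \<in> D' \<Longrightarrow>
       \<alpha> d (?F x) (frechet_derivative ?F (at x) v) = fst v - lam (snd x) (snd v)"
    using E_coordinates[OF uD d] by metis
  have one: "one_form Y \<alpha>" using form by (simp add: contact_form_for_def contact_form_def)
  have lin: "linear (\<alpha> d x)" if "x \<in> chart_ran d" for x
    using one that d(1) unfolding one_form_def by blast
  have diff: "(\<lambda>x. \<alpha> d x w) differentiable (at x)" if x: "x \<in> chart_ran d" for x w
  proof -
    have "smooth_on (chart_ran d) (\<lambda>x. \<alpha> d x w)" using one d(1) by (simp add: one_form_def)
    then obtain U where "x \<in> U" "\<And>k. C_diff k U (\<lambda>x. \<alpha> d x w)"
      using smooth_on_open_C_diff[OF chart_Y(2)[OF d(1)] _ x] by metis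
    then show ?thesis using C_diff_Suc_has_derivative differentiableI by blast
  qed
  have "lam (snd v) (snd w) = 0" for w :: "real \<times> complex"
  proof -
    have "- 2 * lam (snd v) (snd w) = ext_deriv (\<lambda>x w. \<alpha> d (?F x) (frechet_derivative ?F (at x) w)) u v w"
      unfolding ext_deriv_standard[symmetric, of v w u]
      by (rule ext_deriv_cong_open[of "V \<inter> D'"]) (use V(1,2,5) open_D u in auto)
    also have "\<dots> = ext_deriv (\<alpha> d) (?F u) (frechet_derivative ?F (at u) v) (frechet_derivative ?F (at u) w)"
      by (rule ext_deriv_pullback[OF V(4,1,2) _ chart_Y(2)[OF d(1)] lin diff]) (use V(3) in auto)
    also have "\<dots> = 0" using v by (simp add: reeb_vector_def)
    finally show ?thesis by simp
  qed
  \<comment> \<open>The quarter turn of a vector pairs with it under \<open>lam\<close> to half its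
    squared norm.\<close>
  from this[of "(0 :: real, \<i> * snd v)"] have "(Re (snd v))\<^sup>2 + (Im (snd v))\<^sup>2 = 0"
    by (simp add: lam_def power2_eq_square)
  then show ?thesis by (simp add: complex_eq_iff sum_power2_eq_zero_iff)
qed

text \<open>The trajectory is pulled back to the cover by a local inverse of the chart expression of
  \<open>E\<close>. There its velocity is a multiple of the t-direction, so its disk component has
  derivative zero.\<close>

lemma reeb_trajectory_disk_coord:
  assumes traj: "reeb_trajectory Y \<alpha> T \<gamma>" and s: "s \<in> T" "\<gamma> s \<in> E ` D'"
  shows "((\<lambda>s. disk_coord (\<gamma> s)) has_vector_derivative 0) (at s within T)"
proof -
  obtain u where u: "u \<in> D'" "\<gamma> s = E u" using s(2) by blast
  have uD: "u \<in> D" using D'_subset u(1) by (rule subsetD)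
  obtain d where d: "d \<in> Atlas Y" "E u \<in> chart_dom d" using chart_Y_at[OF E_in_Y[OF uD]] .
  let ?F = "\<lambda>x. coord d (E x)"
  obtain V where V: "open V" "u \<in> V" "V \<subseteq> D" "E ` V \<subseteq> chart_dom d" "inj_on ?F V" "\<And>k. C_diff k V ?F"
    "inj (frechet_derivative ?F (at u))"
    using E_coordinates[OF uD d] by metis
  define A where "A = frechet_derivative ?F (at u)"
  have A: "(?F has_derivative A) (at u)"
    unfolding A_def by (rule C_diff_Suc_has_derivative[OF V(6,2)])
  have linA: "linear A" using has_derivative_linear[OF A] .
  obtain B where B: "linear B" "B \<circ> A = id"
    using linear_injective_left_inverse[OF linA] V(7) by (auto simp: A_def)
  \<comment> \<open>By equality of dimensions the injective A is onto, so the Reeb vector is the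
    image of a vector on the cover.\<close>
  have "dim (range A) = DIM(real^3)"
    using dim_image_eq[OF linA, of UNIV] V(7) by (simp add: A_def)
  then have "span (range A) = UNIV" by (rule iffD1[OF dim_eq_full])
  moreover have "span (range A) = range A" using linear_subspace_image[OF linA subspace_UNIV] by (simp add: span_eq_iff)
  ultimately have "surj A" by simp
  define g where "g = the_inv_into V ?F"
  have g: "g (?F x) = x" if "x \<in> V" for x using the_inv_into_f_f[OF V(5) that] by (simp add: g_def)
  have cont: "continuous_on V ?F" using C_diff_imp_continuous_on[OF V(6)] .
  have "open (?F ` V)" by (rule invariance_of_domain_gen[OF V(1) cont V(5)]) simp
  moreover have "continuous_on (?F ` V) g"
    by (rule continuous_on_inverse_open[OF V(1) cont _ g]) simp_all
  ultimately have dg: "(g has_derivative B) (at (?F u))"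
    using has_derivative_inverse_dieudonne[OF V(1) _ cont _ g V(2) A _ B(2)] B(1)
    by (simp add: linear_conv_bounded_linear)
  obtain v where v: "reeb_vector (\<alpha> d) (?F u) v" "((\<lambda>s. coord d (\<gamma> s)) has_vector_derivative v) (at s within T)"
    using traj d s(1) u(2) unfolding reeb_trajectory_def by metis
  obtain w where w: "v = A w" using \<open>surj A\<close> by (metis surjD)
  have "snd w = 0"
    using reeb_vector_E[OF u(1) d] v(1) w by (simp add: A_def)
  moreover have "B v = w" using B(2) w by (metis comp_apply id_apply)
  ultimately have "snd (B v) = 0" by simp
  moreover have "((\<lambda>s. snd (g (coord d (\<gamma> s)))) has_derivative (\<lambda>x. snd (B (x *\<^sub>R v)))) (at s within T)"
    using has_derivative_compose[OF v(2)[unfolded has_vector_derivative_def], of g B] dg u(2)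
    by (intro has_derivative_snd) simp
  ultimately have deriv: "((\<lambda>s. snd (g (coord d (\<gamma> s)))) has_vector_derivative 0) (at s within T)"
    by (simp add: has_vector_derivative_def linear_cmul[OF B(1)])
  have "openin (top_of_set T) {x \<in> T. \<gamma> x \<in> E ` V}"
    using openin_continuous_map_preimage[of "top_of_set T" "Top Y" \<gamma>] openin_E_image[OF V(1,3)] traj
    by (simp add: reeb_trajectory_def)
  moreover have "s \<in> {x \<in> T. \<gamma> x \<in> E ` V}" using s(1) u(2) V(2) by simp
  ultimately obtain r where r: "r > 0" "ball s r \<inter> T \<subseteq> {x \<in> T. \<gamma> x \<in> E ` V}"
    by (meson openin_contains_ball)
  have "snd (g (coord d (\<gamma> x))) = disk_coord (\<gamma> x)" if "x \<in> T" "dist x s < r" for x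
  proof -
    have "\<gamma> x \<in> E ` V" using that r(2) by (auto simp: dist_commute)
    then obtain y where "y \<in> V" "\<gamma> x = E y" by blast
    then show ?thesis using g V(3) disk_coord_E by (simp add: subsetD)
  qed
  then show ?thesis
    by (rule has_vector_derivative_transform_within[OF deriv r(1) s(1)])
qed

text \<open>The disk coordinate is known to be locally constant only while the trajectory is over
  \<open>D'\<close>. Connectedness of the time interval turns this into a global statement: a
  trajectory that starts over the circle of radius r never leaves it. The sign of a does not
  matter.\<close>

lemma no_reeb_chord:
  assumes A: "A \<subseteq> E ` (UNIV \<times> sphere 0 r)" and B: "B \<subseteq> E ` (D - UNIV \<times> sphere 0 r)"
    and r: "pi * r\<^sup>2 < 1 + \<epsilon>'"
  shows "\<not> reeb_chord Y \<alpha> A B a \<gamma>"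
proof
  assume chord: "reeb_chord Y \<alpha> A B a \<gamma>"
  define T where "T = closed_segment 0 a"
  have traj: "reeb_trajectory Y \<alpha> T \<gamma>" and ends: "\<gamma> 0 \<in> A" "\<gamma> a \<in> B" "0 \<in> T" "a \<in> T"
    using chord by (auto simp: reeb_chord_def T_def)
  have cont: "continuous_map (top_of_set T) (Top Y) \<gamma>" using traj by (simp add: reeb_trajectory_def)
  have sub: "(UNIV::real set) \<times> sphere 0 r \<subseteq> D'" using r by (auto simp: area_disk_def)
  note subD = subset_trans[OF sub D'_subset]
  let ?C = "E ` (UNIV \<times> sphere 0 r)"
  \<comment> \<open>\<open>Z\<close> is open and closed in \<open>T\<close>, because the disk coordinate is locally constant along \<open>\<gamma>\<close>.\<close>
  define Z where "Z = {s \<in> T. \<gamma> s \<in> ?C}"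
  \<comment> \<open>The set on the cover is not compact, but its image is that of a torus under
    \<open>e\<close>; in a Hausdorff space it is therefore closed.\<close>
  have "?C = e ` (sphere 0 1 \<times> sphere 0 r)"
  proof
    show "?C \<subseteq> e ` (sphere 0 1 \<times> sphere 0 r)" by (auto simp: E_def Q_cover_def)
    show "e ` (sphere 0 1 \<times> sphere 0 r) \<subseteq> ?C"
    proof clarify
      fix w z :: complex assume wz: "w \<in> sphere 0 1" "z \<in> sphere 0 r"
      then have "(w, z) \<in> sphere 0 1 \<times> area_disk (1 + \<epsilon>')" using r by (auto simp: area_disk_def)
      then obtain u where "Q_cover u = (w, z)" using Q_cover_surj by metis
      then show "e (w, z) \<in> ?C" using wz
        by (intro image_eqI[where x = u]) (auto simp: E_def Q_cover_def split_beta mem_Times_iff)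
    qed
  qed
  moreover have "compactin (Top Y) (e ` (sphere 0 1 \<times> sphere 0 r))"
  proof (rule image_compactin[OF _ e_continuous])
    have "sphere 0 1 \<times> sphere 0 r \<subseteq> sphere 0 1 \<times> area_disk (1 + \<epsilon>)"
      using r eps by (auto simp: area_disk_def)
    then show "compactin (top_of_set (sphere 0 1 \<times> area_disk (1 + \<epsilon>))) (sphere 0 1 \<times> sphere 0 r :: (complex \<times> complex) set)"
      by (auto simp: compactin_subtopology intro!: compact_Times)
  qed
  ultimately have "closedin (Top Y) ?C" using compactin_imp_closedin[OF Hausdorff_Y] by simp
  then have "closedin (top_of_set T) Z"
    using closedin_continuous_map_preimage[OF cont] by (simp add: Z_def)
  moreover have "openin (top_of_set T) Z"
  proof (subst openin_contains_ball, intro conjI ballI)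
    show "Z \<subseteq> T" by (auto simp: Z_def)
    fix s assume s: "s \<in> Z"
    have "openin (top_of_set T) {x \<in> T. \<gamma> x \<in> E ` D'}"
      using openin_continuous_map_preimage[OF cont openin_E_image[OF open_D(2) D'_subset]] by simp
    moreover have "s \<in> {x \<in> T. \<gamma> x \<in> E ` D'}" using s image_mono[OF sub, of E] unfolding Z_def by blast
    ultimately obtain \<rho> where \<rho>: "\<rho> > 0" "ball s \<rho> \<inter> T \<subseteq> {x \<in> T. \<gamma> x \<in> E ` D'}"
      by (meson openin_contains_ball)
    have "\<exists>c. \<forall>x\<in>ball s \<rho> \<inter> T. disk_coord (\<gamma> x) = c"
    proof (rule has_derivative_zero_constant)
      show "convex (ball s \<rho> \<inter> T)" by (simp add: T_def convex_Int)
      fix x assume x: "x \<in> ball s \<rho> \<inter> T"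
      then have "((\<lambda>s. disk_coord (\<gamma> s)) has_vector_derivative 0) (at x within T)"
        using reeb_trajectory_disk_coord[OF traj] \<rho>(2) by blast
      then have "((\<lambda>s. disk_coord (\<gamma> s)) has_vector_derivative 0) (at x within ball s \<rho> \<inter> T)"
        by (rule has_vector_derivative_within_subset) simp
      then show "((\<lambda>s. disk_coord (\<gamma> s)) has_derivative (\<lambda>h. 0)) (at x within ball s \<rho> \<inter> T)"
        by (simp add: has_vector_derivative_def)
    qed
    then obtain c where c: "\<And>x. x \<in> ball s \<rho> \<inter> T \<Longrightarrow> disk_coord (\<gamma> x) = c" by blast
    obtain u where u: "u \<in> UNIV \<times> sphere 0 r" "\<gamma> s = E u" using s by (auto simp: Z_def)
    have "disk_coord (\<gamma> s) = snd u" using u(2) disk_coord_E[OF subsetD[OF subD u(1)]] by simp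
    then have norm_c: "norm c = r" using c[of s] s \<rho>(1) u(1) by (auto simp: Z_def)
    have "x \<in> Z" if x: "x \<in> ball s \<rho> \<inter> T" for x
    proof -
      obtain y where y: "y \<in> D'" "\<gamma> x = E y" using \<rho>(2) x by blast
      then have "snd y = c" using c[OF x] disk_coord_E[of y] subsetD[OF D'_subset y(1)] by simp
      then show ?thesis using norm_c y x by (auto simp: Z_def mem_Times_iff)
    qed
    then show "\<exists>e>0. ball s e \<inter> T \<subseteq> Z" using \<rho>(1) by blast
  qed
  moreover have "connected T" by (simp add: T_def)
  moreover have "0 \<in> Z" using ends A by (auto simp: Z_def)
  ultimately have "Z = T" unfolding connected_clopen by blast
  then have "\<gamma> a \<in> ?C" using ends by (auto simp: Z_def)
  then obtain u where u: "u \<in> UNIV \<times> sphere 0 r" "\<gamma> a = E u" by blast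
  obtain u' where u': "u' \<in> D - UNIV \<times> sphere 0 r" "\<gamma> a = E u'" using ends B by blast
  have "snd u = snd u'"
    using disk_coord_E[OF subsetD[OF subD u(1)]] disk_coord_E[OF DiffD1[OF u'(1)]] u(2) u'(2) by simp
  then show False using u u' by (auto simp: mem_Times_iff)
qed

end

section \<open>Pushing the zero section off itself in the 1-jet space of the circle\<close>

text \<open>In polar coordinates \<lambda> = r^2 d\<psi> / 2: the radial component a drops
  out.\<close>

lemma lam_polar: "lam (R *\<^sub>R z) (a *\<^sub>R z + b *\<^sub>R (\<i> * z)) = R * b * (cmod z)\<^sup>2 / 2"
  unfolding cmod_power2 by (simp add: lam_def power2_eq_square algebra_simps)

text \<open>The circle of area 1 has r^2 = 1/pi, so its share of r^2 d\<psi> / 2 cancels the d\<psi>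
  / (2 pi) coming from dt. The lemma serves twice: with the angle as variable for the Legendrian
  condition, and with the homotopy parameter for the speed. The disk component of \<open>H'\<close>
  already is nonzero, its radial and angular parts being multiples of \<open>y'\<close> and
  \<open>\<psi>'\<close>.\<close>

lemma has_vector_derivative_polar:
  fixes \<psi> y T :: "real \<Rightarrow> real"
  assumes D: "(\<psi> has_real_derivative \<psi>') (at t)" "(y has_real_derivative y') (at t)"
      "(T has_real_derivative T') (at t)"
    and pos: "1 / pi + 2 * \<eta> * y t > 0"
  defines "H \<equiv> \<lambda>t. (\<psi> t / (2 * pi) + \<eta> * T t, sqrt (1 / pi + 2 * \<eta> * y t) *\<^sub>R cis (\<psi> t))"
  obtains H' where "(H has_vector_derivative H') (at t)"
    and "fst H' - lam (snd (H t)) (snd H') = \<eta> * (T' - y t * \<psi>')"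
    and "\<eta> \<noteq> 0 \<Longrightarrow> y' \<noteq> 0 \<or> \<psi>' \<noteq> 0 \<Longrightarrow> H' \<noteq> 0"
proof
  define R where "R = sqrt (1 / pi + 2 * \<eta> * y t)"
  define H' where "H' = (\<psi>' / (2 * pi) + \<eta> * T', (\<eta> * y' / R) *\<^sub>R cis (\<psi> t) + (R * \<psi>') *\<^sub>R (\<i> * cis (\<psi> t)))"
  have R: "R > 0" "R * R = 1 / pi + 2 * \<eta> * y t" using pos by (simp_all add: R_def)
  have "((\<lambda>t. sqrt (1 / pi + 2 * \<eta> * y t)) has_real_derivative \<eta> * y' / R) (at t)"
    using pos by (auto intro!: derivative_eq_intros D(2) simp: R_def field_simps)
  moreover have "((\<lambda>t. cis (\<psi> t)) has_vector_derivative \<psi>' *\<^sub>R (\<i> * cis (\<psi> t))) (at t)"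
    using D(1) unfolding has_real_derivative_iff_has_vector_derivative has_vector_derivative_def
    by (auto intro!: derivative_eq_intros simp: fun_eq_iff scaleR_conv_of_real)
  ultimately have 2: "((\<lambda>t. sqrt (1 / pi + 2 * \<eta> * y t) *\<^sub>R cis (\<psi> t)) has_vector_derivative
      (R *\<^sub>R (\<psi>' *\<^sub>R (\<i> * cis (\<psi> t))) + (\<eta> * y' / R) *\<^sub>R cis (\<psi> t))) (at t)"
    unfolding R_def by (rule has_vector_derivative_scaleR)
  have 1: "((\<lambda>t. \<psi> t / (2 * pi) + \<eta> * T t) has_vector_derivative (\<psi>' / (2 * pi) + \<eta> * T')) (at t)"
    unfolding has_real_derivative_iff_has_vector_derivative[symmetric]
    by (auto intro!: derivative_eq_intros D)
  show "(H has_vector_derivative H') (at t)"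
    using has_vector_derivative_Pair[OF 1 2] unfolding H_def H'_def by (simp add: add.commute)
  have "lam (snd (H t)) (snd H') = R * R * \<psi>' / 2"
    unfolding H_def H'_def R_def[symmetric] by (simp add: lam_polar)
  then have "lam (snd (H t)) (snd H') = \<psi>' / (2 * pi) + \<eta> * y t * \<psi>'"
    unfolding R(2) by (simp add: field_simps)
  then show "fst H' - lam (snd (H t)) (snd H') = \<eta> * (T' - y t * \<psi>')"
    by (simp add: H'_def algebra_simps)
  show "H' \<noteq> 0" if "\<eta> \<noteq> 0" "y' \<noteq> 0 \<or> \<psi>' \<noteq> 0"
  proof
    assume "H' = 0"
    then have "((\<eta> * y' / R) + (R * \<psi>') * \<i>) * cis (\<psi> t) = 0"
      by (simp add: H'_def zero_prod_def scaleR_conv_of_real algebra_simps)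
    then have "(\<eta> * y' / R) + (R * \<psi>') * \<i> = 0" by (simp only: mult_eq_0_iff cis_neq_zero simp_thms)
    then have "\<eta> * y' / R = 0 \<and> R * \<psi>' = 0" by (simp add: complex_eq_iff)
    then show False using that R(1) by simp
  qed
qed

text \<open>Write \<open>z = r cis \<psi>\<close>, \<open>r\<^sup>2 = 1/\<pi> + 2 \<eta> y\<close> and \<open>t = \<psi>/(2\<pi>) + \<eta> T\<close>; then \<open>dt - \<lambda> = \<eta> (dT - y d\<psi>)\<close>.
  The family of curves is \<open>\<psi>' = 1 - 8 s cos \<theta> (1 + 2 sin \<theta> cos \<theta>)\<close>, \<open>y = s (sin \<theta> + 2 s)\<close>, where the
  constant \<open>2 s\<close> is the one for which \<open>T' = y \<psi>'\<close> has mean zero, and \<open>T\<close> is the resulting periodic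
  primitive. Where \<open>y' = 0\<close> one has \<open>\<psi>' = 1\<close>, so the curves are immersed. Everything except the
  summand \<open>\<theta>\<close> of \<open>\<psi>\<close> is a polynomial in \<open>s\<close>, \<open>Re x\<close> and \<open>Im x\<close> for \<open>x = cis \<theta>\<close>. Finally,
  \<open>wave_speed\<close> is \<open>\<partial>\<^sub>s T - y \<partial>\<^sub>s \<psi>\<close>.\<close>

definition wave_phase :: "real \<Rightarrow> complex \<Rightarrow> real" where
  "wave_phase s x = - 8 * s * (Im x - 2 / 3 * (Re x)^3)"

definition wave_height :: "real \<Rightarrow> complex \<Rightarrow> real" where
  "wave_height s x = s * (Im x + 2 * s)"

definition wave_lift :: "real \<Rightarrow> complex \<Rightarrow> real" where
  "wave_lift s x = s * (- Re x + 4 * s * (Re x)^2 + 2 * s * Im x * Re x * (1 - 2 * (Im x)^2)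
     - 16 * s^2 * Im x + 32 / 3 * s^2 * (Re x)^3)"

definition wave_speed :: "real \<Rightarrow> complex \<Rightarrow> real" where
  "wave_speed s x = - Re x + 8 * s * (Re x)^2 + 4 * s * Im x * Re x * (1 - 2 * (Im x)^2)
     - 48 * s^2 * Im x + 32 * s^2 * (Re x)^3 + 8 * wave_height s x * (Im x - 2 / 3 * (Re x)^3)"

definition wave :: "real \<Rightarrow> real \<Rightarrow> real \<Rightarrow> real \<times> complex" where
  "wave \<eta> s t = ((t + wave_phase s (cis t)) / (2 * pi) + \<eta> * wave_lift s (cis t),
     sqrt (1 / pi + 2 * \<eta> * wave_height s (cis t)) *\<^sub>R cis (t + wave_phase s (cis t)))"

definition circle_wave :: "real \<Rightarrow> real \<Rightarrow> complex \<Rightarrow> complex \<times> complex" where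
  "circle_wave \<eta> s x = (x * cis (wave_phase s x + 2 * pi * \<eta> * wave_lift s x),
     sqrt (1 / pi + 2 * \<eta> * wave_height s x) *\<^sub>R (x * cis (wave_phase s x)))"

text \<open>When t grows by 2 pi, the first component of \<open>wave\<close> grows by 1, which
  \<open>Q_cover\<close> does not see. Hence the curve descends to the circle;
  \<open>circle_wave\<close> gives it without a choice of angle, which makes continuity
  immediate.\<close>

lemma Q_cover_wave: "Q_cover (wave \<eta> s t) = circle_wave \<eta> s (cis t)"
proof -
  have "2 * pi * fst (wave \<eta> s t) = t + (wave_phase s (cis t) + 2 * pi * \<eta> * wave_lift s (cis t))"
    by (simp add: wave_def field_simps)
  then show ?thesis by (simp add: Q_cover_def split_beta circle_wave_def cis_mult) (simp add: wave_def)
qed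

section \<open>Bounds and derivatives of the model family\<close>

lemma wave_height_ge: "norm x = 1 \<Longrightarrow> wave_height s x \<ge> - 1 / 8"
proof -
  assume "norm x = 1"
  then have "\<bar>Im x\<bar> \<le> 1" using abs_Im_le_cmod[of x] by simp
  then have "(Im x)\<^sup>2 \<le> 1" by (simp add: abs_square_le_1)
  \<comment> \<open>Completing the square: the height is this square minus (Im x)^2 / 8.\<close>
  moreover have "0 \<le> 2 * (s + Im x / 4)\<^sup>2" by simp
  ultimately show ?thesis by (simp add: wave_height_def power2_eq_square field_simps)
qed

lemma wave_height_le:
  assumes "norm x = 1" "s \<in> {0..1}" shows "wave_height s x \<le> 3"
proof -
  have "Im x \<le> 1" using abs_Im_le_cmod[of x] assms(1) by simp
  then have "s * (Im x + 2 * s) \<le> s * 3" using assms(2) by (intro mult_left_mono) auto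
  also have "\<dots> \<le> 3" using assms(2) by simp
  finally have "s * (Im x + 2 * s) \<le> 3" .
  then show ?thesis by (simp add: wave_height_def)
qed

text \<open>The height is at least - 1/8, and 2/8 < 1/pi because pi < 4. This holds for every real
  s, so \<open>wave\<close> is smooth on the whole plane.\<close>

lemma wave_radius_pos:
  assumes "0 < \<eta>" "\<eta> \<le> 1" "norm x = 1"
  shows "1 / pi + 2 * \<eta> * wave_height s x > 0"
proof -
  have "\<eta> * wave_height s x \<ge> \<eta> * (- 1 / 8)"
    using wave_height_ge[OF assms(3)] assms(1) by (intro mult_left_mono) auto
  moreover have "\<eta> * (- 1 / 8) \<ge> - 1 / 8" using assms(2) by simp
  moreover have "1 / pi > 1 / 4" using pi_less_4 by (simp add: field_simps)
  ultimately show ?thesis by linarith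
qed

lemma wave_derivative_angle:
  assumes "0 < \<eta>" "\<eta> \<le> 1"
  obtains w where "(wave \<eta> s has_vector_derivative w) (at t)" "w \<noteq> 0"
    "fst w = lam (snd (wave \<eta> s t)) (snd w)"
proof -
  let ?p' = "1 - 8 * s * (cos t + 2 * (cos t)^2 * sin t)" and ?y' = "s * cos t"
  let ?T' = "wave_height s (cis t) * ?p'"
  have p: "((\<lambda>t. t + wave_phase s (cis t)) has_real_derivative ?p') (at t)"
    unfolding wave_phase_def by (auto intro!: derivative_eq_intros simp: algebra_simps power2_eq_square)
  have y: "((\<lambda>t. wave_height s (cis t)) has_real_derivative ?y') (at t)"
    unfolding wave_height_def by (auto intro!: derivative_eq_intros)
  have T: "((\<lambda>t. wave_lift s (cis t)) has_real_derivative ?T') (at t)"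
    unfolding wave_lift_def wave_height_def cis.simps
    \<comment> \<open>Both sides carry the factor s. Apart from it, T' = y \<psi>' is a polynomial
      identity in sin t and cos t modulo sin^2 + cos^2 = 1.\<close>
    by ((rule derivative_eq_intros refl)+, simp, rule disjI2)
       (use sin_cos_squared_add[of t] in algebra)
  obtain w where w: "(wave \<eta> s has_vector_derivative w) (at t)"
    "fst w - lam (snd (wave \<eta> s t)) (snd w) = \<eta> * (?T' - wave_height s (cis t) * ?p')"
    "\<eta> \<noteq> 0 \<Longrightarrow> ?y' \<noteq> 0 \<or> ?p' \<noteq> 0 \<Longrightarrow> w \<noteq> 0"
    unfolding wave_def[abs_def]
    by (rule has_vector_derivative_polar[OF p y T wave_radius_pos[OF assms norm_cis]]) blast
  have "?y' \<noteq> 0 \<or> ?p' \<noteq> 0" by auto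
  then show thesis using that[OF w(1) w(3)] w(2) assms(1) by simp
qed

text \<open>Joint smoothness on the whole plane, not only for s in [0,1], supplies the extensions
  across s = 0 and s = 1 that \<open>smooth_on\<close> asks for.\<close>

lemma C_diff_wave:
  assumes "0 < \<eta>" "\<eta> \<le> 1"
  shows "C_diff k UNIV (\<lambda>p. wave \<eta> (fst p) (snd p))"
proof -
  have r: "C_diff k UNIV (\<lambda>p::real \<times> real. sqrt (1 / pi + 2 * \<eta> * wave_height (fst p) (cis (snd p))))"
  proof (rule C_diff_compose[OF open_UNIV C_diff_sqrt])
    show "C_diff k UNIV (\<lambda>p::real \<times> real. 1 / pi + 2 * \<eta> * wave_height (fst p) (cis (snd p)))"
      unfolding wave_height_def cis.simps
      by (intro open_UNIV C_diff_const C_diff_add C_diff_mult C_diff_trig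
          C_diff_bounded_linear bounded_linear_fst bounded_linear_snd)
    show "(\<lambda>p::real \<times> real. 1 / pi + 2 * \<eta> * wave_height (fst p) (cis (snd p))) ` UNIV \<subseteq> {0<..}"
      using wave_radius_pos[OF assms, of "cis _"] by auto
  qed
  have p: "C_diff k UNIV (\<lambda>p::real \<times> real. snd p + wave_phase (fst p) (cis (snd p)))"
    unfolding wave_phase_def cis.simps
    by (intro open_UNIV C_diff_const C_diff_add C_diff_mult C_diff_diff C_diff_power C_diff_trig
          C_diff_bounded_linear bounded_linear_fst bounded_linear_snd)
  have l: "C_diff k UNIV (\<lambda>p::real \<times> real. wave_lift (fst p) (cis (snd p)))"
    unfolding wave_lift_def cis.simps
    by (intro open_UNIV C_diff_const C_diff_add C_diff_mult C_diff_diff C_diff_power C_diff_uminus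
          C_diff_trig C_diff_bounded_linear bounded_linear_fst bounded_linear_snd)
  show ?thesis
    unfolding wave_def
    by (intro open_UNIV C_diff_Pair C_diff_add C_diff_mult C_diff_const C_diff_divide_const
        C_diff_scaleR C_diff_trig(3) p r l)
qed

text \<open>\<open>wave_speed\<close> is free of \<eta>, so the speed is proportional to
  \<eta>.\<close>

lemma wave_derivative_time:
  assumes "0 < \<eta>" "\<eta> \<le> 1"
  obtains w where "((\<lambda>s. wave \<eta> s t) has_vector_derivative w) (at s)"
    "fst w - lam (snd (wave \<eta> s t)) (snd w) = \<eta> * wave_speed s (cis t)"
proof -
  let ?x = "cis t"
  let ?p' = "- 8 * (Im ?x - 2 / 3 * (Re ?x)^3)" and ?y' = "Im ?x + 4 * s"
  let ?T' = "- Re ?x + 8 * s * (Re ?x)^2 + 4 * s * Im ?x * Re ?x * (1 - 2 * (Im ?x)^2)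
     - 48 * s^2 * Im ?x + 32 * s^2 * (Re ?x)^3"
  have p: "((\<lambda>s. t + wave_phase s ?x) has_real_derivative ?p') (at s)"
    unfolding wave_phase_def by (auto intro!: derivative_eq_intros simp: algebra_simps)
  have y: "((\<lambda>s. wave_height s ?x) has_real_derivative ?y') (at s)"
    unfolding wave_height_def by (auto intro!: derivative_eq_intros)
  have T: "((\<lambda>s. wave_lift s ?x) has_real_derivative ?T') (at s)"
    unfolding wave_lift_def
    by (auto intro!: derivative_eq_intros simp: algebra_simps power2_eq_square power3_eq_cube)
  obtain w where w: "((\<lambda>s. wave \<eta> s t) has_vector_derivative w) (at s)"
    "fst w - lam (snd (wave \<eta> s t)) (snd w) = \<eta> * (?T' - wave_height s ?x * ?p')"
    unfolding wave_def
    by (rule has_vector_derivative_polar[OF p y T wave_radius_pos[OF assms norm_cis]]) blast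
  show thesis using that[OF w(1)] w(2) by (simp add: wave_speed_def algebra_simps)
qed

lemma wave_speed_bounded:
  obtains C where "C > 0" "\<And>s x. s \<in> {0..1} \<Longrightarrow> norm x = 1 \<Longrightarrow> \<bar>wave_speed s x\<bar> \<le> C"
proof -
  have "compact ({0..1} \<times> sphere 0 1 :: (real \<times> complex) set)" by (intro compact_Times) auto
  moreover have "continuous_on ({0..1} \<times> sphere 0 1) (\<lambda>p. wave_speed (fst p) (snd p))"
    unfolding wave_speed_def wave_height_def by (intro continuous_intros)
  ultimately have "bounded ((\<lambda>p. wave_speed (fst p) (snd p)) ` ({0..1} \<times> sphere 0 1))"
    by (intro compact_imp_bounded compact_continuous_image)
  then obtain C where "C > 0" "\<And>p. p \<in> {0..1} \<times> sphere 0 1 \<Longrightarrow> \<bar>wave_speed (fst p) (snd p)\<bar> \<le> C"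
    unfolding bounded_pos by auto
  then show thesis by (intro that[of C]) force+
qed

section \<open>The homotopy in Y\<close>

context contact_cylinder begin

definition pushoff :: "real \<Rightarrow> real \<Rightarrow> complex \<Rightarrow> 'y" where
  "pushoff \<eta> s x = e (circle_wave \<eta> s x)"

lemma pushoff_cis: "pushoff \<eta> s (cis t) = E (wave \<eta> s t)"
  by (simp add: pushoff_def E_def Q_cover_wave)

text \<open>The start of the homotopy is independent of \<eta>, so a single Legendrian serves every
  \<delta>.\<close>

lemma pushoff_0: "pushoff \<eta> 0 x = e (x, sqrt (1 / pi) *\<^sub>R x)"
  by (simp add: pushoff_def circle_wave_def wave_phase_def wave_height_def wave_lift_def)

text \<open>The bound 1 keeps the radicand of \<open>wave\<close> positive. Heights are at most 3
  and \<pi> r^2 = 1 + 2 \<pi> \<eta> y, so the last condition keeps the whole family over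
  \<open>B(1 + \<epsilon>')\<close>.\<close>

context
  fixes \<eta> :: real
  assumes \<eta>: "0 < \<eta>" "\<eta> \<le> 1" "6 * pi * \<eta> < \<epsilon>'"
begin

lemma wave_norm: "pi * (cmod (snd (wave \<eta> s t)))\<^sup>2 = 1 + 2 * pi * \<eta> * wave_height s (cis t)"
  using wave_radius_pos[OF \<eta>(1,2), of "cis t" s] by (simp add: wave_def algebra_simps)

lemma wave_in_D':
  assumes "s \<in> {0..1}" shows "wave \<eta> s t \<in> D'"
proof -
  have "2 * pi * \<eta> * wave_height s (cis t) \<le> 2 * pi * \<eta> * 3"
    using wave_height_le[of "cis t" s] assms \<eta>(1) by (intro mult_left_mono) auto
  also have "\<dots> < \<epsilon>'" using \<eta>(3) by (simp add: mult_ac)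
  finally show ?thesis by (simp add: mem_Times_iff area_disk_def wave_norm)
qed

lemma wave_in_D: "s \<in> {0..1} \<Longrightarrow> wave \<eta> s t \<in> D"
  using subsetD[OF D'_subset wave_in_D'] .

lemma continuous_pushoff:
  "continuous_map (top_of_set ({0..1} \<times> sphere 0 1)) (Top Y) (\<lambda>p. pushoff \<eta> (fst p) (snd p))"
  unfolding pushoff_def
proof (rule continuous_map_compose[OF _ e_continuous, unfolded o_def])
  show "continuous_map (top_of_set ({0..1} \<times> sphere 0 1)) (top_of_set (sphere 0 1 \<times> area_disk (1 + \<epsilon>)))
      (\<lambda>p. circle_wave \<eta> (fst p) (snd p))"
    unfolding continuous_map_in_subtopology continuous_map_iff_continuous
  proof
    show "continuous_on ({0..1} \<times> sphere 0 1) (\<lambda>p. circle_wave \<eta> (fst p) (snd p))"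
      unfolding circle_wave_def wave_phase_def wave_height_def wave_lift_def
      by (intro continuous_intros)
    have "circle_wave \<eta> s x \<in> sphere 0 1 \<times> area_disk (1 + \<epsilon>)"
      if "s \<in> {0..1}" "x \<in> sphere 0 1" for s x
      using sphere_cis[OF that(2)] Q_cover_in[OF wave_in_D[OF that(1)]] Q_cover_wave by metis
    then show "(\<lambda>p. circle_wave \<eta> (fst p) (snd p)) \<in> topspace (top_of_set ({0..1} \<times> sphere 0 1))
        \<rightarrow> sphere 0 1 \<times> area_disk (1 + \<epsilon>)" by auto
  qed
qed

lemma legendrian_pushoff:
  assumes s: "s \<in> {0..1}"
  shows "legendrian_immersion circle Y \<xi> (pushoff \<eta> s)"
proof -
  have "\<exists>w. \<forall>t. (wave \<eta> s has_vector_derivative w t) (at t) \<and> w t \<noteq> 0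
      \<and> fst (w t) = lam (snd (wave \<eta> s t)) (snd (w t))"
    using wave_derivative_angle[OF \<eta>(1,2), of s] by (intro choice allI) metis
  then obtain w where w: "\<And>t. (wave \<eta> s has_vector_derivative w t) (at t)" "\<And>t. w t \<noteq> 0"
      "\<And>t. fst (w t) = lam (snd (wave \<eta> s t)) (snd (w t))" by blast
  show ?thesis
  proof (rule legendrian_immersion_E[OF _ pushoff_cis _ wave_in_D[OF s] w])
    have "continuous_map (top_of_set (sphere 0 1)) (top_of_set ({0..1} \<times> sphere 0 1)) (Pair s)"
      using s by (auto simp: continuous_map_in_subtopology intro!: continuous_intros)
    from continuous_map_compose[OF this continuous_pushoff]
    show "continuous_map (Top circle) (Top Y) (pushoff \<eta> s)" by (simp add: o_def)
    show "C_diff k UNIV (wave \<eta> s)" for k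
      using C_diff_compose[OF open_UNIV C_diff_wave[OF \<eta>(1,2)], of k "Pair s"]
      by (simp add: C_diff_Pair C_diff_const C_diff_bounded_linear[OF bounded_linear_ident])
  qed
qed

text \<open>On a chart of the circle the local representation agrees with the chart expression of
  \<open>E\<close> composed with \<open>wave\<close>, which is smooth near (s, u) in the plane also
  when s is 0 or 1.\<close>

lemma regular_homotopy_pushoff: "legendrian_regular_homotopy circle Y \<xi> (pushoff \<eta>)"
  unfolding legendrian_regular_homotopy_def smooth_family_def
proof (intro conjI ballI legendrian_pushoff)
  show "continuous_map (prod_topology (top_of_set {0..1}) (Top circle)) (Top Y) (\<lambda>(s, x). pushoff \<eta> s x)"
    using continuous_pushoff by (simp add: case_prod_beta')
  fix c d assume c: "c \<in> Atlas circle" and d: "d \<in> Atlas Y"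
  obtain W where W: "open W" "inj_on cis W" "c = (cis ` W, the_inv_into W cis)"
    using Atlas_circleE[OF c] .
  show "smooth_on {(s, u). s \<in> {0..1} \<and> u \<in> chart_ran c \<and> pushoff \<eta> s (inv_coord c u) \<in> chart_dom d}
      (\<lambda>(s, u). local_rep c (pushoff \<eta> s) d u)"
  proof (rule smooth_onI)
    let ?S = "{(s, u). s \<in> {0..1} \<and> u \<in> chart_ran c \<and> pushoff \<eta> s (inv_coord c u) \<in> chart_dom d}"
    let ?H = "\<lambda>p. wave \<eta> (fst p) (snd p)"
    have S: "fst p \<in> {0..1} \<and> snd p \<in> W \<and> E (?H p) \<in> chart_dom d" if "p \<in> ?S" for p
    proof -
      have "snd p \<in> W" using that W by auto
      then show ?thesis using that inv_coord_cover[OF W(2)] W(3) pushoff_cis by auto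
    qed
    fix p assume "p \<in> ?S"
    then have p: "fst p \<in> {0..1}" "E (?H p) \<in> chart_dom d" using S by blast+
    obtain U where U: "open U" "p \<in> U" "\<And>k. C_diff k U (\<lambda>p. coord d (E (?H p)))"
      by (rule E_compose_C_diff[OF open_UNIV C_diff_wave[OF \<eta>(1,2)] UNIV_I wave_in_D[OF p(1)] d p(2)])
        blast
    have "coord d (E (?H q)) = (\<lambda>(s, u). local_rep c (pushoff \<eta> s) d u) q" if "q \<in> ?S" for q
      using S[OF that] inv_coord_cover[OF W(2), of "snd q"] W(3)
      by (simp add: split_beta local_rep_def pushoff_cis)
    with U show "\<exists>U g. open U \<and> p \<in> U \<and> (\<forall>k. C_diff k U g)
        \<and> (\<forall>q\<in>?S \<inter> U. g q = (\<lambda>(s, u). local_rep c (pushoff \<eta> s) d u) q)"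
      by blast
  qed
qed

lemma homotopy_speed_pushoff:
  assumes "s \<in> {0..1}" "x \<in> sphere 0 1"
  shows "homotopy_speed Y \<alpha> (pushoff \<eta>) s x = \<eta> * wave_speed s x"
proof -
  obtain t where t: "x = cis t" using sphere_cis[OF assms(2)] .
  obtain w where w: "((\<lambda>s. wave \<eta> s t) has_vector_derivative w) (at s)"
    "fst w - lam (snd (wave \<eta> s t)) (snd w) = \<eta> * wave_speed s x"
    using wave_derivative_time[OF \<eta>(1,2)] t by metis
  show ?thesis
    unfolding w(2)[symmetric]
    by (rule homotopy_speed_E[OF _ assms(1) wave_in_D'[OF assms(1)] w(1)]) (simp add: t pushoff_cis)
qed

lemma oscillation_energy_pushoff:
  assumes C: "C > 0" "\<And>s x. s \<in> {0..1} \<Longrightarrow> norm x = 1 \<Longrightarrow> \<bar>wave_speed s x\<bar> \<le> C"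
  shows "oscillation_energy circle Y \<alpha> (pushoff \<eta>) \<le> 2 * \<eta> * C"
proof -
  let ?h = "homotopy_speed Y \<alpha> (pushoff \<eta>)"
  let ?f = "\<lambda>s. (SUP x\<in>topspace (Top circle). ?h s x) - (INF x\<in>topspace (Top circle). ?h s x)"
  have ne: "sphere (0::complex) 1 \<noteq> {}" by simp
  have osc: "?f s \<le> 2 * \<eta> * C" if s: "s \<in> {0..1}" for s
  proof -
    have "\<bar>?h s x\<bar> \<le> \<eta> * C" if "x \<in> sphere 0 1" for x
      using homotopy_speed_pushoff[OF s that] C(2)[OF s, of x] that \<eta>(1)
      by (simp add: abs_mult mult_left_mono)
    then have "?h s x \<le> \<eta> * C \<and> - (\<eta> * C) \<le> ?h s x" if "x \<in> sphere 0 1" for x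
      using that by (meson abs_le_D1 abs_le_D2 minus_le_iff)
    then have "(SUP x\<in>sphere 0 1. ?h s x) \<le> \<eta> * C" "- (\<eta> * C) \<le> (INF x\<in>sphere 0 1. ?h s x)"
      by (intro cSUP_least cINF_greatest ne; blast)+
    then show ?thesis by simp
  qed
  show ?thesis
  \<comment> \<open>Without integrability \<open>integral\<close> is 0 by convention, which the
    nonnegative bound covers too.\<close>
  proof (cases "?f integrable_on {0..1}")
    case True
    have "integral {0..1} ?f \<le> integral {0..1} (\<lambda>s::real. 2 * \<eta> * C)"
      by (rule integral_le[OF True integrable_const_ivl osc])
    then show ?thesis by (simp add: oscillation_energy_def)
  next
    case False
    then show ?thesis using \<eta>(1) C(1) by (simp add: oscillation_energy_def not_integrable_integral)
  qed
qed

lemma no_reeb_chord_pushoff: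
  "\<not> reeb_chord Y \<alpha> (pushoff \<eta> 0 ` sphere 0 1) (pushoff \<eta> 1 ` sphere 0 1) a \<gamma>"
proof (rule no_reeb_chord[where r = "sqrt (1 / pi)"])
  show "pushoff \<eta> 0 ` sphere 0 1 \<subseteq> E ` (UNIV \<times> sphere 0 (sqrt (1 / pi)))"
  proof clarify
    fix x :: complex assume "x \<in> sphere 0 1"
    then obtain t where "x = cis t" by (rule sphere_cis)
    moreover have "snd (wave \<eta> 0 t) \<in> sphere 0 (sqrt (1 / pi))"
      by (simp add: wave_def wave_height_def)
    ultimately show "pushoff \<eta> 0 x \<in> E ` (UNIV \<times> sphere 0 (sqrt (1 / pi)))"
      using pushoff_cis by (intro image_eqI[where x = "wave \<eta> 0 t"]) (auto simp: mem_Times_iff)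
  qed
  show "pushoff \<eta> 1 ` sphere 0 1 \<subseteq> E ` (D - UNIV \<times> sphere 0 (sqrt (1 / pi)))"
  proof clarify
    fix x :: complex assume "x \<in> sphere 0 1"
    then obtain t where t: "x = cis t" by (rule sphere_cis)
    \<comment> \<open>At s = 1 the height is sin t + 2, so the projected curve lies strictly outside
      the circle of area 1.\<close>
    have "sin t + 2 > 0" using sin_ge_minus_one[of t] by linarith
    then have "pi * (cmod (snd (wave \<eta> 1 t)))\<^sup>2 > 1" unfolding wave_norm using \<eta>(1)
      by (simp add: wave_height_def)
    then have "cmod (snd (wave \<eta> 1 t)) \<noteq> sqrt (1 / pi)" by (auto simp: real_sqrt_divide power_divide)
    then have "wave \<eta> 1 t \<in> D - UNIV \<times> sphere 0 (sqrt (1 / pi))"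
      using wave_in_D[of 1 t] by (simp add: mem_Times_iff)
    then show "pushoff \<eta> 1 x \<in> E ` (D - UNIV \<times> sphere 0 (sqrt (1 / pi)))"
      unfolding t pushoff_cis by (rule imageI)
  qed
  show "pi * (sqrt (1 / pi))\<^sup>2 < 1 + \<epsilon>'"
    using \<eta> by (simp, smt (verit) mult_pos_pos pi_gt_zero)
qed

text \<open>At s = 0 the first component of \<open>circle_wave\<close> is x itself, so the map is
  injective; continuity from a compact space to a Hausdorff space does the rest.\<close>

lemma legendrian_embedding_pushoff_0: "legendrian_embedding circle Y \<xi> (pushoff \<eta> 0)"
proof -
  have leg: "legendrian_immersion circle Y \<xi> (pushoff \<eta> 0)" by (rule legendrian_pushoff) simp
  moreover have "embedding_map (Top circle) (Top Y) (pushoff \<eta> 0)"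
  proof (rule continuous_imp_embedding_map[OF _ compact_space_circle Hausdorff_Y])
    show "continuous_map (Top circle) (Top Y) (pushoff \<eta> 0)"
      using leg by (simp add: legendrian_immersion_def immersion_def smooth_map_def)
    have "x = y" if "x \<in> sphere 0 1" "y \<in> sphere 0 1" "pushoff \<eta> 0 x = pushoff \<eta> 0 y" for x y
    proof -
      have "circle_wave \<eta> 0 z \<in> sphere 0 1 \<times> area_disk (1 + \<epsilon>)" if "z \<in> sphere 0 1" for z
        using sphere_cis[OF that] Q_cover_in[OF wave_in_D[of 0]] Q_cover_wave by (metis atLeastAtMost_iff le_numeral_extra(3) zero_le_one)
      then have "circle_wave \<eta> 0 x = circle_wave \<eta> 0 y"
        using that inj_onD[OF e_inj] unfolding pushoff_def by metis
      then show ?thesis by (simp add: circle_wave_def wave_phase_def wave_lift_def)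
    qed
    then show "inj_on (pushoff \<eta> 0) (topspace (Top circle))" by (auto intro: inj_onI)
  qed
  ultimately show ?thesis
    by (simp add: legendrian_embedding_def smooth_embedding_def legendrian_immersion_def)
qed

end

end

theorem theorem4:
  fixes Y :: "('y, real^3) mfd"
    and \<xi> :: "('y, real^3) tangent_field"
    and \<alpha> :: "('y, real^3) form"
    and e :: "complex \<times> complex \<Rightarrow> 'y"
    and \<epsilon> \<epsilon>' :: real
  assumes "smooth_manifold Y"
    and "contact_structure Y \<xi>"
    and "\<epsilon> > 0"
    and "contact_embedding (Q (1 + \<epsilon>)) (ker_form Q_form) Y \<xi> e"
    and "0 < \<epsilon>'" and "\<epsilon>' < \<epsilon>"
    and "contact_form_for Y \<xi> \<alpha>"
    and "pulls_back_on (topspace (Top (Q (1 + \<epsilon>')))) (Q (1 + \<epsilon>)) Y e \<alpha> Q_form"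
  shows "\<exists>(L :: (complex, real) mfd) j.
           smooth_manifold L \<and> compact_space (Top L) \<and> topspace (Top L) \<noteq> {} \<and>
           legendrian_embedding L Y \<xi> j \<and>
           (\<forall>\<delta>>0. \<exists>i. legendrian_regular_homotopy L Y \<xi> i \<and>
              (\<forall>x\<in>topspace (Top L). i 0 x = j x) \<and>
              oscillation_energy L Y \<alpha> i < \<delta> \<and>
              (\<nexists>a \<gamma>. reeb_chord Y \<alpha> (i 0 ` topspace (Top L)) (i 1 ` topspace (Top L)) a \<gamma>))"
proof -
  interpret contact_cylinder Y \<xi> \<alpha> e \<epsilon> \<epsilon>'
    using assms by unfold_locales
  obtain C where C: "C > 0" "\<And>s x. s \<in> {0..1} \<Longrightarrow> norm x = 1 \<Longrightarrow> \<bar>wave_speed s x\<bar> \<le> C"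
    using wave_speed_bounded by metis
  \<comment> \<open>C bounds \<open>wave_speed\<close> for all \<eta> at once, so \<eta> can be
    chosen after it; supremum minus infimum of the speed is at most 2 \<eta> C.\<close>
  have small: "\<exists>\<eta>. 0 < \<eta> \<and> \<eta> \<le> 1 \<and> 6 * pi * \<eta> < \<epsilon>' \<and> 2 * \<eta> * C < \<delta>" if "\<delta> > 0" for \<delta>
  proof -
    have "\<forall>\<^sub>F \<eta> in at_right 0. \<eta> < 1 \<and> 6 * pi * \<eta> < \<epsilon>' \<and> 2 * \<eta> * C < \<delta> \<and> 0 < (\<eta>::real)"
      by (intro eventually_conj order_tendstoD(2)[where y = 0] eventually_at_right_less)
         (use that assms(5) in \<open>auto intro!: tendsto_eq_intros\<close>)
    then have "\<exists>\<eta>. \<eta> < 1 \<and> 6 * pi * \<eta> < \<epsilon>' \<and> 2 * \<eta> * C < \<delta> \<and> 0 < (\<eta>::real)"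
      using eventually_happens'[OF trivial_limit_at_right_real] by blast
    then show ?thesis by (meson less_imp_le)
  qed
  show ?thesis
  proof (intro exI[of _ circle] exI[of _ "pushoff 1 0"] conjI allI impI)
    \<comment> \<open>The parameter 1 in \<open>pushoff 1 0\<close> may violate 6 \<pi> \<eta> <
      \<epsilon>'. The embedding property is taken from an admissible \<eta> and transferred through
      the formula common to all \<eta>.\<close>
    obtain \<eta> where "0 < \<eta>" "\<eta> \<le> 1" "6 * pi * \<eta> < \<epsilon>'" using small[of 1] by auto
    from legendrian_embedding_pushoff_0[OF this]
    have "legendrian_embedding circle Y \<xi> (\<lambda>x. e (x, sqrt (1 / pi) *\<^sub>R x))"
      by (simp add: pushoff_0[abs_def])
    then show "legendrian_embedding circle Y \<xi> (pushoff 1 0)" by (simp add: pushoff_0[abs_def])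
  next
    fix \<delta> :: real assume "\<delta> > 0"
    then obtain \<eta> where \<eta>: "0 < \<eta>" "\<eta> \<le> 1" "6 * pi * \<eta> < \<epsilon>'" "2 * \<eta> * C < \<delta>"
      using small by blast
    show "\<exists>i. legendrian_regular_homotopy circle Y \<xi> i \<and>
        (\<forall>x\<in>topspace (Top circle). i 0 x = pushoff 1 0 x) \<and> oscillation_energy circle Y \<alpha> i < \<delta> \<and>
        (\<nexists>a \<gamma>. reeb_chord Y \<alpha> (i 0 ` topspace (Top circle)) (i 1 ` topspace (Top circle)) a \<gamma>)"
      using regular_homotopy_pushoff[OF \<eta>(1-3)] oscillation_energy_pushoff[OF \<eta>(1-3) C] \<eta>(4)
        no_reeb_chord_pushoff[OF \<eta>(1-3)]
      by (intro exI[of _ "pushoff \<eta>"] conjI) (auto simp: pushoff_0)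
  next
    have "1 \<in> topspace (Top circle)" by simp
    then show "topspace (Top circle) \<noteq> {}" by (metis empty_iff)
  qed (rule smooth_manifold_circle compact_space_circle)+
qed

end
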